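(* Reduced order propagator $\widetilde{\mathbf P}\in\mathbb R^{mn\times mn}$ and transducer matrix $\widetilde{\mathbf B}\in\mathbb R^{mn\times m}$ that solve the interpolation problem $$\mathbf D^k=\widetilde{\mathbf B}^*\,T_k(\widetilde{\mathbf P})\,\widetilde{\mathbf B},\qquad k=0,\ldots,2n-1,$$ are orthogonal projections $$\widetilde{\mathbf P}=\mathbf V^*(P\mathbf V),\qquad \widetilde{\mathbf B}=\mathbf V^*\mathbf b,$$ of the true propagator $P=\cos\big(\tau\sqrt{-\widehat A}\big)$ and of the transducer function $\mathbf b$ on the block Krylov subspace $\mathcal K_n(P,\mathbf b)$, where $\mathbf V=[\mathbf v^0,\mathbf v^1,\ldots,\mathbf v^{n-1}]$ is an orthonormal basis for $\mathcal K_n(P,\mathbf b)$ in the sense that $\mathbf V^*\mathbf V=\mathbf I_{mn}$, and the products are understood in the sense of the matrix product defined in the context, in particular $$\widetilde{\mathbf B}=\begin{bmatrix}(\mathbf v^0)^*\mathbf b\\ (\mathbf v^1)^*\mathbf b\\ \vdots\\ (\mathbf v^{n-1})^*\mathbf b\end{bmatrix}.$$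
   Context: Domain and operator. $\Omega\subset\mathbb R^d$, $d=2,3$, is a finite domain with boundary split into an accessible part $\mathcal B_A$ and an inaccessible part $\mathcal B_I=\partial\Omega\setminus\mathcal B_A$. The acoustic velocity $c(x)$ is piecewise smooth in $\Omega$. The operator $A=c(x)^2\Delta$ is considered with homogeneous Neumann conditions on $\mathcal B_A$ and homogeneous Dirichlet conditions on $\mathcal B_I$. The symmetrized operator is $\widehat A=c(x)\Delta c(x)$ (that is, $\widehat A w=c\,\Delta(c\,w)$), a similarity transform of $A$, $A=c\,\widehat A\,c^{-1}$; it is self-adjoint with respect to the standard inner product $\langle f,g\rangle=\int_\Omega\overline{f(x)}\,g(x)\,dx$. Functions of $\widehat A$ are operator functions. Transducer function. There are $m$ transducers acting as both sources and receivers. The source wavelet $q$ is an even, sufficiently smooth approximation of the delta function $\delta(t)$ with nonnegative Fourier transform $\widetilde q(s^2)=\int_0^\infty 2\cos(ts)\,q(t)\,dt$. The distributions $e_1,\ldots,e_m$ have disjoint supports in $\mathcal B_A$ and act on smooth test functions by $\int_\Omega f e_j\,dx=\int_{\mathrm{supp}\,e_j} f\,d\Sigma$, with $d\Sigma$ the surface element; $\theta$ is a known function. The transducer function is the row-vector-valued function $\mathbf b=[b_1,\ldots,b_m]:\Omega\to\mathbb R^{1\times m}$ with $b_j=\widetilde q^{1/2}(-\widehat A)\,\theta e_j$. Notation. Operators act on row-vector-valued functions component-wise. For row-vector-valued functions $\mathbf y=[y_1,\ldots,y_p]$ and $\mathbf z=[z_1,\ldots,z_r]$ on $\Omega$, $\mathbf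 y^*\mathbf z$ denotes the $p\times r$ matrix with entries $\langle y_i,z_j\rangle$. $T_k$ is the Chebyshev polynomial of the first kind of degree $k$. $\mathbf I_p$ is the $p\times p$ identity matrix. Data. The data are sampled uniformly in time at $t_k=k\tau$, $k=0,\ldots,2n-1$, with sampling interval $\tau$: $\mathbf D^k=\mathbf b^*\cos\big(k\tau\sqrt{-\widehat A}\big)\mathbf b=\mathbf b^*\,T_k(P)\,\mathbf b\in\mathbb R^{m\times m}$, where $P=\cos\big(\tau\sqrt{-\widehat A}\big)$ is the propagator. Snapshots and Krylov subspace. The symmetrized snapshots are $\widehat{\mathbf u}^k=\cos\big(k\tau\sqrt{-\widehat A}\big)\mathbf b=T_k(P)\mathbf b$, each a row of $m$ functions. The block Krylov subspace is $\mathcal K_n(P,\mathbf b)=\mathrm{span}\{\widehat{\mathbf u}^0,\ldots,\widehat{\mathbf u}^{n-1}\}=\mathrm{span}\{\mathbf b,P\mathbf b,\ldots,P^{n-1}\mathbf b\}$ (the span of all component functions), of dimension $mn$. An orthonormal basis for it is written $\mathbf V=[\mathbf v^0,\ldots,\mathbf v^{n-1}]:\Omega\to\mathbb R^{1\times mn}$ with $\mathbf v^k:\Omega\to\mathbb R^{1\times m}$; orthonormality $\mathbf V^*\mathbf V=\mathbf I_{mn}$ means $(\mathbf v^i)^*\mathbf v^j=\delta_{ij}\mathbf I_m$ for $i,j=0,\ldots,n-1$.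
   Formalization: The claim that every solution of the interpolation problem is an orthogonal projection is proved for symmetric reduced order propagators; without symmetry it fails, since a non-orthogonal similarity transform fixing the transducer matrix can preserve the data. *)

theory Defs
  imports "HOL-Analysis.Analysis" "Jordan_Normal_Form.Matrix"
begin

section \<open>Real $L^2$ spaces\<close>

text \<open>
  All functions in the statement are real valued, so the complex conjugation in the inner product
  is the identity and we work in the real space $L^2$. Elements are functions rather than
  classes; identities between them hold almost everywhere.
\<close>

definition L2 :: "'x measure \<Rightarrow> ('x \<Rightarrow> 'b::euclidean_space) set" where
  "L2 \<mu> = {f. f \<in> borel_measurable \<mu> \<and> integrable \<mu> (\<lambda>x. (norm (f x))\<^sup>2)}"

definition L2_inner :: "'x measure \<Rightarrow> ('x \<Rightarrow> 'b::euclidean_space) \<Rightarrow> ('x \<Rightarrow> 'b) \<Rightarrow> real" where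
  "L2_inner \<mu> f g = (LINT x|\<mu>. inner (f x) (g x))"

definition L2_converges ::
    "'x measure \<Rightarrow> (nat \<Rightarrow> 'x \<Rightarrow> 'b::euclidean_space) \<Rightarrow> ('x \<Rightarrow> 'b) \<Rightarrow> bool" where
  "L2_converges \<mu> v u \<longleftrightarrow> (\<lambda>n. LINT x|\<mu>. (norm (v n x - u x))\<^sup>2) \<longlonglongrightarrow> 0"


section \<open>Unbounded operators, self-adjointness, operator functions\<close>

text \<open>An unbounded operator is given by its graph, closed under almost everywhere equality.\<close>

type_synonym 'x opgraph = "(('x \<Rightarrow> real) \<times> ('x \<Rightarrow> real)) set"

definition adjoint_graph :: "'x measure \<Rightarrow> 'x opgraph \<Rightarrow> 'x opgraph" where
  "adjoint_graph \<mu> A = {(y, z). y \<in> L2 \<mu> \<and> z \<in> L2 \<mu> \<and>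
     (\<forall>(w, g) \<in> A. L2_inner \<mu> y g = L2_inner \<mu> z w)}"

definition self_adjoint :: "'x measure \<Rightarrow> 'x opgraph \<Rightarrow> bool" where
  "self_adjoint \<mu> A \<longleftrightarrow>
     (\<forall>f \<in> L2 \<mu>. \<forall>\<epsilon>>0. \<exists>(w, g) \<in> A. (LINT x|\<mu>. (f x - w x)\<^sup>2) < \<epsilon>) \<and>
     A = adjoint_graph \<mu> A"

definition neg_graph :: "'x opgraph \<Rightarrow> 'x opgraph" where
  "neg_graph A = {(w, \<lambda>x. - g x) | w g. (w, g) \<in> A}"

text \<open>
  Operator functions are those of the spectral theorem in multiplication form:
  \<open>U\<close> is a unitary map from $L^2(\mu)$ onto $L^2(M)$ carrying \<open>A\<close>, with its
  domain, to multiplication by the real function \<open>a\<close>, and \<open>f(A)\<close> corresponds to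
  multiplication by \<open>f \<circ> a\<close>. Every self-adjoint operator has such a representation, and
  \<open>f(A)\<close> does not depend on its choice. An expansion in orthonormal eigenfunctions is the
  case of a counting measure \<open>M\<close>.
\<close>

definition spectral_representation ::
    "'x measure \<Rightarrow> 'x opgraph \<Rightarrow> 's measure \<Rightarrow> (('x \<Rightarrow> real) \<Rightarrow> 's \<Rightarrow> real) \<Rightarrow> ('s \<Rightarrow> real) \<Rightarrow> bool" where
  "spectral_representation \<mu> A M U a \<longleftrightarrow>
     a \<in> borel_measurable M \<and>
     (\<forall>f \<in> L2 \<mu>. U f \<in> L2 M) \<and>
     (\<forall>f \<in> L2 \<mu>. \<forall>g \<in> L2 \<mu>. \<forall>r s.
        AE z in M. U (\<lambda>x. r * f x + s * g x) z = r * U f z + s * U g z) \<and>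
     (\<forall>f \<in> L2 \<mu>. \<forall>g \<in> L2 \<mu>. L2_inner M (U f) (U g) = L2_inner \<mu> f g) \<and>
     (\<forall>h \<in> L2 M. \<exists>f \<in> L2 \<mu>. AE z in M. U f z = h z) \<and>
     A \<subseteq> L2 \<mu> \<times> L2 \<mu> \<and>
     (\<forall>w \<in> L2 \<mu>. \<forall>g \<in> L2 \<mu>. (w, g) \<in> A \<longleftrightarrow> (AE z in M. U g z = a z * U w z))"

definition op_fun ::
    "'x measure \<Rightarrow> 's measure \<Rightarrow> (('x \<Rightarrow> real) \<Rightarrow> 's \<Rightarrow> real) \<Rightarrow> ('s \<Rightarrow> real) \<Rightarrow>
     (real \<Rightarrow> real) \<Rightarrow> ('x \<Rightarrow> real) \<Rightarrow> ('x \<Rightarrow> real)" where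
  "op_fun \<mu> M U a f w = (SOME y. y \<in> L2 \<mu> \<and> (AE z in M. U y z = f (a z) * U w z))"


section \<open>The operator $\widehat A = c\,\Delta\,c$ with mixed boundary conditions\<close>

text \<open>\<open>C_k k S f\<close>: continuous partial derivatives up to order \<open>k\<close> on the open set \<open>S\<close>.\<close>

primrec C_k :: "nat \<Rightarrow> 'a::euclidean_space set \<Rightarrow> ('a \<Rightarrow> real) \<Rightarrow> bool" where
  "C_k 0 S f \<longleftrightarrow> continuous_on S f"
| "C_k (Suc k) S f \<longleftrightarrow> f differentiable_on S \<and>
     (\<forall>i\<in>Basis. C_k k S (\<lambda>x. frechet_derivative f (at x) i))"

definition smooth_on :: "'a::euclidean_space set \<Rightarrow> ('a \<Rightarrow> real) \<Rightarrow> bool" where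
  "smooth_on S f \<longleftrightarrow> (\<forall>k. C_k k S f)"

definition grad :: "('a::euclidean_space \<Rightarrow> real) \<Rightarrow> 'a \<Rightarrow> 'a" where
  "grad f x = (\<Sum>i\<in>Basis. frechet_derivative f (at x) i *\<^sub>R i)"

text \<open>On each piece the function is smooth up to the boundary of the piece.\<close>

definition piecewise_smooth :: "'a::euclidean_space set \<Rightarrow> ('a \<Rightarrow> real) \<Rightarrow> bool" where
  "piecewise_smooth \<Omega> c \<longleftrightarrow>
     (\<exists>\<U>. finite \<U> \<and> disjoint \<U> \<and> negligible (\<Omega> - \<Union>\<U>) \<and>
       (\<forall>X\<in>\<U>. open X \<and> X \<subseteq> \<Omega> \<and>
          (\<exists>W g. open W \<and> closure X \<subseteq> W \<and> smooth_on W g \<and> (\<forall>x\<in>X. c x = g x))))"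

definition mixed_test :: "'a::euclidean_space set \<Rightarrow> 'a set \<Rightarrow> ('a \<Rightarrow> real) set" where
  "mixed_test \<Omega> B\<^sub>I = {v. smooth_on \<Omega> v \<and> v \<in> L2 (lebesgue_on \<Omega>) \<and> grad v \<in> L2 (lebesgue_on \<Omega>) \<and>
     (\<exists>N. open N \<and> B\<^sub>I \<subseteq> N \<and> (\<forall>x \<in> \<Omega> \<inter> N. v x = 0))}"

text \<open>
  Functions in $H^1(\Omega)$ vanishing on \<open>B\<^sub>I\<close>, paired with their weak gradients: the
  $H^1$ closure of the test functions.
\<close>

definition H1_mixed :: "'a::euclidean_space set \<Rightarrow> 'a set \<Rightarrow> (('a \<Rightarrow> real) \<times> ('a \<Rightarrow> 'a)) set" where
  "H1_mixed \<Omega> B\<^sub>I = {(u, G). u \<in> L2 (lebesgue_on \<Omega>) \<and> G \<in> L2 (lebesgue_on \<Omega>) \<and>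
     (\<exists>v. (\<forall>n. v n \<in> mixed_test \<Omega> B\<^sub>I) \<and>
        L2_converges (lebesgue_on \<Omega>) v u \<and> L2_converges (lebesgue_on \<Omega>) (\<lambda>n. grad (v n)) G)}"

text \<open>
  The weak form of $\Delta u = f$ with $u = 0$ on \<open>B\<^sub>I\<close> and $\partial_\nu u = 0$ on the rest of the
  boundary; the Neumann condition is the natural one, since the test functions are
  unconstrained there.
\<close>

definition mixed_laplacian :: "'a::euclidean_space set \<Rightarrow> 'a set \<Rightarrow> 'a opgraph" where
  "mixed_laplacian \<Omega> B\<^sub>I = {(u, f). u \<in> L2 (lebesgue_on \<Omega>) \<and> f \<in> L2 (lebesgue_on \<Omega>) \<and>
     (\<exists>G. (u, G) \<in> H1_mixed \<Omega> B\<^sub>I \<and>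
       (\<forall>v \<in> mixed_test \<Omega> B\<^sub>I.
          L2_inner (lebesgue_on \<Omega>) G (grad v) = - L2_inner (lebesgue_on \<Omega>) f v))}"

text \<open>
  Since $\widehat A = c^{-1} (c^2 \Delta) c$, the boundary conditions are those of $c\,w$.
\<close>

definition A_hat :: "'a::euclidean_space set \<Rightarrow> 'a set \<Rightarrow> ('a \<Rightarrow> real) \<Rightarrow> 'a opgraph" where
  "A_hat \<Omega> B\<^sub>I c = {(w, g). w \<in> L2 (lebesgue_on \<Omega>) \<and> g \<in> L2 (lebesgue_on \<Omega>) \<and>
     (\<exists>f. (\<lambda>x. c x * w x, f) \<in> mixed_laplacian \<Omega> B\<^sub>I \<and>
          (AE x in lebesgue_on \<Omega>. g x = c x * f x))}"


section \<open>Transducer function\<close>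

text \<open>
  The surface element is the $(d-1)$-dimensional Hausdorff measure, normalised to agree with
  surface area.
\<close>

definition hausdorff_outer :: "real \<Rightarrow> 'a::euclidean_space set \<Rightarrow> ennreal" where
  "hausdorff_outer s X =
     (SUP \<delta> \<in> {0<..}.
        INF C \<in> {C :: nat \<Rightarrow> 'a set. X \<subseteq> (\<Union>i. C i) \<and> (\<forall>i. bounded (C i) \<and> diameter (C i) \<le> \<delta>)}.
          \<Sum>i. ennreal (unit_ball_vol s * (diameter (C i) / 2) powr s))"

definition surface_measure :: "'a::euclidean_space measure" where
  "surface_measure = measure_of UNIV (sets borel) (hausdorff_outer (real DIM('a) - 1))"

text \<open>$\widetilde q$ as a function of $\lambda = s^2$.\<close>

definition q_tilde :: "(real \<Rightarrow> real) \<Rightarrow> real \<Rightarrow> real" where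
  "q_tilde q l = (LINT t:{0..}|lborel. 2 * cos (t * sqrt l) * q t)"

text \<open>
  \<open>is_op_fun_surface\<close> says that the function \<open>b\<close> in $L^2(\Omega)$ is $F\,\theta e$, where \<open>e\<close> is the
  surface distribution with support \<open>S\<close> and \<open>F\<close> is a bounded self-adjoint operator. As $\theta e$ is not a
  function, $F\,\theta e$ is defined by duality,
  $\langle w, F\,\theta e\rangle = \langle F w, \theta e\rangle = \int_S \theta\,(F w)\,d\Sigma$,
  for all \<open>w\<close> for which $F w$ has boundary values on \<open>S\<close>, that is, a representative \<open>\<phi>\<close>
  continuous up to the boundary near \<open>S\<close>.
\<close>

definition is_op_fun_surface ::
    "'a::euclidean_space set \<Rightarrow> (('a \<Rightarrow> real) \<Rightarrow> ('a \<Rightarrow> real)) \<Rightarrow> ('a \<Rightarrow> real) \<Rightarrow> 'a set \<Rightarrow> ('a \<Rightarrow> real) \<Rightarrow> bool" where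
  "is_op_fun_surface \<Omega> F \<theta> S b \<longleftrightarrow> b \<in> L2 (lebesgue_on \<Omega>) \<and>
     (\<forall>w \<in> L2 (lebesgue_on \<Omega>). \<forall>\<phi>.
        (AE x in lebesgue_on \<Omega>. \<phi> x = F w x) \<and>
        (\<exists>N. open N \<and> S \<subseteq> N \<and> continuous_on (closure \<Omega> \<inter> N) \<phi>) \<longrightarrow>
        L2_inner (lebesgue_on \<Omega>) w b = (LINT x:S|surface_measure. \<theta> x * \<phi> x))"


section \<open>Row-vector-valued functions, Krylov subspace, interpolation\<close>

text \<open>
  A row-vector-valued function with \<open>p\<close> components is a sequence of functions of which the first
  \<open>p\<close> are used; \<open>star \<mu> p r y z\<close> is the \<open>p \<times> r\<close> matrix $\mathbf y^* \mathbf z$.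
\<close>

definition star ::
    "'x measure \<Rightarrow> nat \<Rightarrow> nat \<Rightarrow> (nat \<Rightarrow> 'x \<Rightarrow> real) \<Rightarrow> (nat \<Rightarrow> 'x \<Rightarrow> real) \<Rightarrow> real mat" where
  "star \<mu> p r y z = Matrix.mat p r (\<lambda>(i, j). L2_inner \<mu> (y i) (z j))"

text \<open>The concatenation $[\mathbf v^0, \mathbf v^1, \ldots]$ of blocks of \<open>m\<close> functions each.\<close>

definition blocks :: "nat \<Rightarrow> (nat \<Rightarrow> nat \<Rightarrow> 'x \<Rightarrow> real) \<Rightarrow> nat \<Rightarrow> 'x \<Rightarrow> real" where
  "blocks m v i = v (i div m) (i mod m)"

definition L2_span :: "'x measure \<Rightarrow> nat \<Rightarrow> (nat \<Rightarrow> 'x \<Rightarrow> real) \<Rightarrow> ('x \<Rightarrow> real) set" where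
  "L2_span \<mu> N f = {g. \<exists>\<alpha> :: nat \<Rightarrow> real. AE x in \<mu>. g x = (\<Sum>i<N. \<alpha> i * f i x)}"

definition L2_independent :: "'x measure \<Rightarrow> nat \<Rightarrow> (nat \<Rightarrow> 'x \<Rightarrow> real) \<Rightarrow> bool" where
  "L2_independent \<mu> N f \<longleftrightarrow>
     (\<forall>\<alpha> :: nat \<Rightarrow> real. (AE x in \<mu>. (\<Sum>i<N. \<alpha> i * f i x) = 0) \<longrightarrow> (\<forall>i<N. \<alpha> i = 0))"

definition has_L2_dim :: "'x measure \<Rightarrow> ('x \<Rightarrow> real) set \<Rightarrow> nat \<Rightarrow> bool" where
  "has_L2_dim \<mu> K N \<longleftrightarrow> (\<exists>f. L2_independent \<mu> N f \<and> L2_span \<mu> N f = K)"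

definition krylov ::
    "'x measure \<Rightarrow> nat \<Rightarrow> nat \<Rightarrow> (('x \<Rightarrow> real) \<Rightarrow> ('x \<Rightarrow> real)) \<Rightarrow> (nat \<Rightarrow> 'x \<Rightarrow> real) \<Rightarrow> ('x \<Rightarrow> real) set" where
  "krylov \<mu> m n P b = L2_span \<mu> (m * n) (blocks m (\<lambda>k j. (P ^^ k) (b j)))"

definition orthonormal_basis ::
    "'x measure \<Rightarrow> nat \<Rightarrow> (nat \<Rightarrow> 'x \<Rightarrow> real) \<Rightarrow> ('x \<Rightarrow> real) set \<Rightarrow> bool" where
  "orthonormal_basis \<mu> N V K \<longleftrightarrow>
     (\<forall>i<N. V i \<in> L2 \<mu>) \<and> star \<mu> N N V V = 1\<^sub>m N \<and> L2_span \<mu> N V = K"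

text \<open>The Chebyshev polynomial $T_k$ evaluated at a square matrix.\<close>

fun cheb_mat :: "nat \<Rightarrow> real mat \<Rightarrow> real mat" where
  "cheb_mat 0 X = 1\<^sub>m (dim_row X)"
| "cheb_mat (Suc 0) X = X"
| "cheb_mat (Suc (Suc k)) X = 2 \<cdot>\<^sub>m (X * cheb_mat (Suc k) X) - cheb_mat k X"

definition interpolates :: "nat \<Rightarrow> (nat \<Rightarrow> real mat) \<Rightarrow> real mat \<Rightarrow> real mat \<Rightarrow> bool" where
  "interpolates n D Pt Bt \<longleftrightarrow> (\<forall>k<2 * n. D k = transpose_mat Bt * cheb_mat k Pt * Bt)"

end

theory Submission
  imports Defs "Jordan_Normal_Form.Determinant"
begin

text \<open>
  Both sides of the interpolation conditions depend only on moments, and matching the Chebyshev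
  moments up to degree $2n-1$ amounts to matching the power moments $b^* P^i b$, $i < 2n$. If \<open>V\<close> is an
  orthonormal basis of the Krylov subspace, then $X = V^* P V$ and $Y = V^* b$ satisfy
  $X^k Y = V^* P^k b$ for $k \<le> n$, and splitting $i = i_1 + j_1$ with $i_1 < n$, $j_1 \<le> n$ gives the
  moments. Conversely, if \<open>X\<close> is symmetric and the moments match, the Krylov basis \<open>K\<close> and the matrix
  $L = [Y, XY, \<dots>, X^{n-1}Y]$ satisfy $K^* K = L^T L$ and $K^* P K = L^T X L$, so $V = K L^{-1}$ is
  the required orthonormal basis.
\<close>

section \<open>Inner products in $L^2$\<close>

lemma L2_real_iff: "f \<in> L2 \<mu> \<longleftrightarrow> f \<in> borel_measurable \<mu> \<and> integrable \<mu> (\<lambda>x. (f x)\<^sup>2)"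
  for f :: "'x \<Rightarrow> real"
  by (simp add: L2_def)

lemma L2_inner_real: "L2_inner \<mu> f g = (LINT x|\<mu>. f x * g x)"
  by (simp add: L2_inner_def)

lemma L2_inner_commute: "L2_inner \<mu> f g = L2_inner \<mu> g f"
  for f g :: "'x \<Rightarrow> real"
  by (simp add: L2_inner_real mult.commute)

lemma L2_measurable: "f \<in> L2 \<mu> \<Longrightarrow> f \<in> borel_measurable \<mu>"
  by (simp add: L2_def)

lemma L2_mult_integrable:
  fixes f g :: "'x \<Rightarrow> real"
  assumes "f \<in> L2 \<mu>" "g \<in> L2 \<mu>"
  shows "integrable \<mu> (\<lambda>x. f x * g x)"
proof (rule Bochner_Integration.integrable_bound)
  show "integrable \<mu> (\<lambda>x. (f x)\<^sup>2 + (g x)\<^sup>2)"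
    using assms by (simp add: L2_real_iff)
  show "(\<lambda>x. f x * g x) \<in> borel_measurable \<mu>"
    using assms by (intro borel_measurable_times L2_measurable)
  have "\<bar>u * v\<bar> \<le> u\<^sup>2 + v\<^sup>2" for u v :: real
    using sum_squares_bound[of "\<bar>u\<bar>" "\<bar>v\<bar>"] mult_nonneg_nonneg[of "\<bar>u\<bar>" "\<bar>v\<bar>"]
    unfolding abs_mult power2_abs by linarith
  then show "AE x in \<mu>. norm (f x * g x) \<le> norm ((f x)\<^sup>2 + (g x)\<^sup>2)"
    by simp
qed

lemma L2_add:
  fixes f g :: "'x \<Rightarrow> real"
  assumes "f \<in> L2 \<mu>" "g \<in> L2 \<mu>"
  shows "(\<lambda>x. f x + g x) \<in> L2 \<mu>"
  using assms L2_mult_integrable[OF assms]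
  by (auto simp: L2_real_iff power2_sum mult.assoc)

text \<open>Bounded functions of the operator act in the spectral representation as multipliers of
  this kind; a constant multiplier gives \<open>L2_scale\<close>.\<close>

lemma L2_bounded_mult:
  fixes f g :: "'x \<Rightarrow> real"
  assumes f: "f \<in> borel_measurable \<mu>" "\<And>x. \<bar>f x\<bar> \<le> C" and g: "g \<in> L2 \<mu>"
  shows "(\<lambda>x. f x * g x) \<in> L2 \<mu>"
  unfolding L2_real_iff
proof
  show m: "(\<lambda>x. f x * g x) \<in> borel_measurable \<mu>"
    using f(1) L2_measurable[OF g] by (rule borel_measurable_times)
  show "integrable \<mu> (\<lambda>x. (f x * g x)\<^sup>2)"
  proof (rule Bochner_Integration.integrable_bound)
    show "integrable \<mu> (\<lambda>x. C\<^sup>2 * (g x)\<^sup>2)"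
      using g by (simp add: L2_real_iff)
    show "(\<lambda>x. (f x * g x)\<^sup>2) \<in> borel_measurable \<mu>"
      using m by simp
    have "(f x)\<^sup>2 \<le> C\<^sup>2" for x
      using f(2)[of x] by (metis abs_ge_zero power2_abs power_mono)
    then show "AE x in \<mu>. norm ((f x * g x)\<^sup>2) \<le> norm (C\<^sup>2 * (g x)\<^sup>2)"
      by (simp add: power_mult_distrib mult_right_mono)
  qed
qed

lemma L2_scale: "g \<in> L2 \<mu> \<Longrightarrow> (\<lambda>x. g x * (r :: real)) \<in> L2 \<mu>"
  using L2_bounded_mult[of "\<lambda>x. r" \<mu> "\<bar>r\<bar>" g] by (simp add: mult.commute)

lemma L2_zero: "(\<lambda>x. 0 :: real) \<in> L2 \<mu>"
  by (simp add: L2_real_iff)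

lemma L2_sum:
  fixes f :: "nat \<Rightarrow> 'x \<Rightarrow> real"
  assumes "\<And>i. i < N \<Longrightarrow> f i \<in> L2 \<mu>"
  shows "(\<lambda>x. \<Sum>i<N. f i x * r i) \<in> L2 \<mu>"
  using assms by (induction N) (auto intro!: L2_add L2_scale L2_zero)

lemma L2_inner_sum_right:
  fixes f :: "nat \<Rightarrow> 'x \<Rightarrow> real"
  assumes "\<And>i. i < N \<Longrightarrow> f i \<in> L2 \<mu>" "g \<in> L2 \<mu>"
  shows "L2_inner \<mu> g (\<lambda>x. \<Sum>i<N. f i x * r i) = (\<Sum>i<N. L2_inner \<mu> g (f i) * r i)"
proof -
  have "L2_inner \<mu> g (\<lambda>x. \<Sum>i<N. f i x * r i) = (LINT x|\<mu>. (\<Sum>i<N. (g x * f i x) * r i))"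
    by (simp add: L2_inner_real sum_distrib_left mult.assoc)
  also have "\<dots> = (\<Sum>i<N. (LINT x|\<mu>. (g x * f i x) * r i))"
    using assms by (intro Bochner_Integration.integral_sum integrable_mult_left L2_mult_integrable) auto
  finally show ?thesis
    by (simp add: L2_inner_real)
qed

lemma L2_inner_cong_AE:
  fixes f g h :: "'x \<Rightarrow> real"
  assumes "f \<in> L2 \<mu>" "g \<in> L2 \<mu>" "h \<in> L2 \<mu>" "AE x in \<mu>. f x = g x"
  shows "L2_inner \<mu> h f = L2_inner \<mu> h g"
  unfolding L2_inner_real using assms
  by (intro integral_cong_AE borel_measurable_times L2_measurable) auto

lemma L2_inner_self_eq_0:
  fixes f :: "'x \<Rightarrow> real"
  assumes "f \<in> L2 \<mu>" "L2_inner \<mu> f f = 0"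
  shows "AE x in \<mu>. f x = 0"
  using integral_nonneg_eq_0_iff_AE[OF L2_mult_integrable[OF assms(1,1)]] assms(2)
  by (simp add: L2_inner_real)

section \<open>Matrix products of rows of functions\<close>

text \<open>This is component \<open>i\<close> of the product of the row \<open>y\<close> with the
  matrix \<open>C\<close>. With coefficients on the right, iterated combinations correspond to the
  product \<open>C * C'\<close> in the same order.\<close>

definition comb :: "nat \<Rightarrow> (nat \<Rightarrow> 'x \<Rightarrow> real) \<Rightarrow> real mat \<Rightarrow> nat \<Rightarrow> 'x \<Rightarrow> real" where
  "comb N y C i = (\<lambda>x. \<Sum>p<N. y p x * C $$ (p, i))"

lemma comb_L2: "(\<And>p. p < N \<Longrightarrow> y p \<in> L2 \<mu>) \<Longrightarrow> comb N y C i \<in> L2 \<mu>"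
  unfolding comb_def by (rule L2_sum)

lemma index_mult_mat_sum:
  "A \<in> carrier_mat nr N \<Longrightarrow> B \<in> carrier_mat N nc \<Longrightarrow> i < nr \<Longrightarrow> j < nc \<Longrightarrow>
    (A * B) $$ (i, j) = (\<Sum>p<N. A $$ (i, p) * B $$ (p, j))"
  by (auto simp: scalar_prod_def lessThan_atLeast0 intro!: sum.cong)

lemma comb_comb:
  assumes "C \<in> carrier_mat N N'" "C' \<in> carrier_mat N' r" "i < r"
  shows "comb N' (comb N y C) C' i x = comb N y (C * C') i x"
proof -
  have "comb N' (comb N y C) C' i x
      = (\<Sum>p<N'. \<Sum>l<N. y l x * (C $$ (l, p) * C' $$ (p, i)))"
    by (simp add: comb_def sum_distrib_right mult.assoc)
  also have "\<dots> = (\<Sum>l<N. \<Sum>p<N'. y l x * (C $$ (l, p) * C' $$ (p, i)))"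
    by (rule sum.swap)
  also have "\<dots> = comb N y (C * C') i x"
    using assms by (simp add: comb_def index_mult_mat_sum[of C N N' C' r] sum_distrib_left del: index_mult_mat)
  finally show ?thesis .
qed

lemma comb_one: "i < N \<Longrightarrow> comb N y (1\<^sub>m N) i x = y i x"
  unfolding comb_def by (subst sum.cong[OF refl, of _ _ "\<lambda>p. if p = i then y i x else 0"]) auto

lemma star_carrier [simp]: "star \<mu> p r y z \<in> carrier_mat p r"
  by (simp add: star_def)

lemma star_index [simp]:
  "i < p \<Longrightarrow> j < r \<Longrightarrow> star \<mu> p r y z $$ (i, j) = L2_inner \<mu> (y i) (z j)"
  by (simp add: star_def)

lemma star_dim [simp]: "dim_row (star \<mu> p r y z) = p" "dim_col (star \<mu> p r y z) = r"
  by (simp_all add: star_def)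

lemma star_cong:
  "(\<And>i j. i < p \<Longrightarrow> j < r \<Longrightarrow> L2_inner \<mu> (y i) (z j) = L2_inner \<mu>' (y' i) (z' j)) \<Longrightarrow>
    star \<mu> p r y z = star \<mu>' p r y' z'"
  by (auto simp: star_def)

lemma star_transpose: "transpose_mat (star \<mu> p r y z) = star \<mu> r p z y"
  by (rule eq_matI) (auto simp: L2_inner_commute)

text \<open>This is the rule y^* (z C) = (y^* z) C. The row \<open>w\<close> equals z C only almost
  everywhere, which over a general measure does not make it measurable; hence its membership in
  \<open>L2\<close> is a separate assumption.\<close>

lemma star_comb_right:
  assumes "\<And>i. i < p \<Longrightarrow> y i \<in> L2 \<mu>" "\<And>i. i < N \<Longrightarrow> z i \<in> L2 \<mu>"
    and "\<And>i. i < r \<Longrightarrow> w i \<in> L2 \<mu>" "\<And>i. i < r \<Longrightarrow> AE x in \<mu>. w i x = comb N z C i x"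
    and C: "C \<in> carrier_mat N r"
  shows "star \<mu> p r y w = star \<mu> p N y z * C"
proof (rule eq_matI)
  fix i j
  assume "i < dim_row (star \<mu> p N y z * C)" "j < dim_col (star \<mu> p N y z * C)"
  then have ij: "i < p" "j < r"
    using C by auto
  have "L2_inner \<mu> (y i) (w j) = L2_inner \<mu> (y i) (comb N z C j)"
    using assms ij by (intro L2_inner_cong_AE comb_L2) auto
  also have "\<dots> = (\<Sum>p<N. L2_inner \<mu> (y i) (z p) * C $$ (p, j))"
    unfolding comb_def using assms ij by (intro L2_inner_sum_right) auto
  also have "\<dots> = (star \<mu> p N y z * C) $$ (i, j)"
    using ij by (simp add: index_mult_mat_sum[OF star_carrier C] del: index_mult_mat)
  finally show "star \<mu> p r y w $$ (i, j) = (star \<mu> p N y z * C) $$ (i, j)"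
    using ij by simp
qed (use C in auto)

lemma star_comb_left:
  assumes "\<And>i. i < p \<Longrightarrow> y i \<in> L2 \<mu>" "\<And>i. i < N \<Longrightarrow> z i \<in> L2 \<mu>"
    and "\<And>i. i < r \<Longrightarrow> w i \<in> L2 \<mu>" "\<And>i. i < r \<Longrightarrow> AE x in \<mu>. w i x = comb N z C i x"
    and C: "C \<in> carrier_mat N r"
  shows "star \<mu> r p w y = transpose_mat C * star \<mu> N p z y"
proof -
  have "star \<mu> p r y w = star \<mu> p N y z * C"
    by (rule star_comb_right) (use assms in auto)
  then have "star \<mu> r p w y = transpose_mat (star \<mu> p N y z * C)"
    using star_transpose[of \<mu> p r y w] by simp
  also have "\<dots> = transpose_mat C * transpose_mat (star \<mu> p N y z)"
    using C by (intro transpose_mult[of _ p N]) auto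
  finally show ?thesis
    by (simp add: star_transpose)
qed

section \<open>Spans up to null sets and changes of basis\<close>

lemma L2_span_comb_matrix:
  assumes "\<And>i. i < r \<Longrightarrow> w i \<in> L2_span \<mu> N y"
  shows "\<exists>C\<in>carrier_mat N r. \<forall>i<r. AE x in \<mu>. w i x = comb N y C i x"
proof -
  have "\<forall>i. \<exists>\<alpha> :: nat \<Rightarrow> real. i < r \<longrightarrow> (AE x in \<mu>. w i x = (\<Sum>p<N. \<alpha> p * y p x))"
    using assms unfolding L2_span_def by blast
  from choice[OF this] obtain \<alpha> :: "nat \<Rightarrow> nat \<Rightarrow> real"
    where \<alpha>: "\<And>i. i < r \<Longrightarrow> AE x in \<mu>. w i x = (\<Sum>p<N. \<alpha> i p * y p x)"
    by blast
  have "AE x in \<mu>. w i x = comb N y (Matrix.mat N r (\<lambda>(p, i). \<alpha> i p)) i x" if "i < r" for i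
    using \<alpha>[OF that] that by (simp add: comb_def mult.commute)
  then show ?thesis
    by (intro bexI[of _ "Matrix.mat N r (\<lambda>(p, i). \<alpha> i p)"]) auto
qed

lemma L2_span_member:
  assumes "i < N"
  shows "y i \<in> L2_span \<mu> N y"
proof -
  have *: "y i x = (\<Sum>p<N. of_bool (p = i) * y p x)" for x
  proof -
    have "(\<Sum>p<N. of_bool (p = i) * y p x) = (\<Sum>p<N. if p = i then y p x else 0)"
      by (intro sum.cong) auto
    then show ?thesis
      using assms by simp
  qed
  show ?thesis
    unfolding L2_span_def by (intro CollectI exI[of _ "\<lambda>p. of_bool (p = i)"] AE_I2) (rule *)
qed

lemma comb_L2_span_subset:
  assumes "C \<in> carrier_mat N r" "\<And>i. i < r \<Longrightarrow> AE x in \<mu>. w i x = comb N y C i x"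
  shows "L2_span \<mu> r w \<subseteq> L2_span \<mu> N y"
proof
  fix g assume "g \<in> L2_span \<mu> r w"
  then obtain \<alpha> :: "nat \<Rightarrow> real" where \<alpha>: "AE x in \<mu>. g x = (\<Sum>i<r. \<alpha> i * w i x)"
    by (auto simp: L2_span_def)
  \<comment> \<open>The finitely many exceptional null sets are merged into one, so that the sums
    can be rearranged at a fixed point \<open>x\<close>.\<close>
  have "AE x in \<mu>. \<forall>i<r. w i x = comb N y C i x"
    unfolding lessThan_iff[symmetric] Ball_def[symmetric]
    by (rule AE_finite_allI) (use assms(2) in auto)
  with \<alpha> have "AE x in \<mu>. g x = (\<Sum>p<N. (\<Sum>i<r. \<alpha> i * C $$ (p, i)) * y p x)"
  proof eventually_elim
    case (elim x)
    have "g x = (\<Sum>i<r. \<Sum>p<N. \<alpha> i * C $$ (p, i) * y p x)"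
      using elim by (simp add: comb_def sum_distrib_left mult_ac)
    also have "\<dots> = (\<Sum>p<N. \<Sum>i<r. \<alpha> i * C $$ (p, i) * y p x)"
      by (rule sum.swap)
    finally show ?case
      by (simp add: sum_distrib_right)
  qed
  then show "g \<in> L2_span \<mu> N y"
    by (auto simp: L2_span_def)
qed

text \<open>One inclusion holds for every \<open>C\<close>; for the other, y = (y C) C' writes
  \<open>y\<close> as a combination of the new row.\<close>

lemma comb_inverse_span:
  assumes C: "C \<in> carrier_mat N N" "C' \<in> carrier_mat N N" "C * C' = 1\<^sub>m N"
  shows "L2_span \<mu> N (comb N y C) = L2_span \<mu> N y"
proof
  show "L2_span \<mu> N (comb N y C) \<subseteq> L2_span \<mu> N y"
    by (rule comb_L2_span_subset[of C]) (use C in auto)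
  show "L2_span \<mu> N y \<subseteq> L2_span \<mu> N (comb N y C)"
    by (rule comb_L2_span_subset[of C']) (use C in \<open>auto simp: comb_comb[of C N N C' N] comb_one\<close>)
qed

lemma L2_independentD:
  assumes "L2_independent \<mu> N f" "AE x in \<mu>. (\<Sum>i<N. \<alpha> i * f i x) = 0" "i < N"
  shows "\<alpha> i = 0"
  using assms unfolding L2_independent_def by simp

text \<open>The change of basis between the \<open>N\<close> spanning elements and a basis has a right inverse;
  for square matrices this is a two-sided inverse, so the spanning elements are independent as well.\<close>

lemma spanning_imp_independent:
  assumes "has_L2_dim \<mu> (L2_span \<mu> N y) N"
  shows "L2_independent \<mu> N y"
  unfolding L2_independent_def
proof (intro allI impI)
  fix \<alpha> :: "nat \<Rightarrow> real" and l
  assume zero: "AE x in \<mu>. (\<Sum>i<N. \<alpha> i * y i x) = 0" and l: "l < N"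
  obtain f where ind: "L2_independent \<mu> N f" and span: "L2_span \<mu> N f = L2_span \<mu> N y"
    using assms by (auto simp: has_L2_dim_def)
  have mem: "f i \<in> L2_span \<mu> N y" "y i \<in> L2_span \<mu> N f" if "i < N" for i
    using that L2_span_member[of i N f \<mu>] L2_span_member[of i N y \<mu>] span by auto
  obtain A where A: "A \<in> carrier_mat N N" "\<And>i. i < N \<Longrightarrow> AE x in \<mu>. f i x = comb N y A i x"
    using L2_span_comb_matrix[of N f, OF mem(1)] by blast
  obtain B where B: "B \<in> carrier_mat N N" "\<And>i. i < N \<Longrightarrow> AE x in \<mu>. y i x = comb N f B i x"
    using L2_span_comb_matrix[of N y, OF mem(2)] by blast
  have allB: "AE x in \<mu>. \<forall>i\<in>{..<N}. y i x = comb N f B i x"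
    by (rule AE_finite_allI) (use B in auto)
  \<comment> \<open>Inserting y = f B into f = y A gives f = f (B A), and independence of
    \<open>f\<close> allows coefficients to be compared.\<close>
  have BA: "B * A = 1\<^sub>m N"
  proof (rule eq_matI)
    fix i j assume "i < dim_row (1\<^sub>m N :: real mat)" "j < dim_col (1\<^sub>m N :: real mat)"
    then have ij: "i < N" "j < N" by auto
    have "AE x in \<mu>. (\<Sum>p<N. ((B * A) $$ (p, j) - of_bool (p = j)) * f p x) = 0"
      using allB A(2)[OF ij(2)]
    proof eventually_elim
      case (elim x)
      have "f j x = comb N (comb N f B) A j x"
        using elim by (simp add: comb_def)
      also have "\<dots> = comb N f (B * A) j x"
        using B(1) A(1) ij(2) by (rule comb_comb)
      finally have "comb N f (B * A) j x - comb N f (1\<^sub>m N) j x = 0"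
        using ij by (simp add: comb_one)
      moreover have "(\<Sum>p<N. ((B * A) $$ (p, j) - of_bool (p = j)) * f p x)
          = comb N f (B * A) j x - comb N f (1\<^sub>m N) j x"
        unfolding comb_def sum_subtractf[symmetric] using ij
        by (intro sum.cong) (auto simp: algebra_simps simp del: index_mult_mat)
      ultimately show ?case by simp
    qed
    then have "(B * A) $$ (i, j) - of_bool (i = j) = 0"
      by (rule L2_independentD[OF ind _ ij(1)])
    then show "(B * A) $$ (i, j) = 1\<^sub>m N $$ (i, j)"
      using ij by (simp del: index_mult_mat)
  qed (use A B in auto)
  then have AB: "A * B = 1\<^sub>m N"
    using mat_mult_left_right_inverse[OF B(1) A(1)] by simp
  \<comment> \<open>In terms of \<open>f\<close>, the relation on \<open>y\<close> has coefficient
    vector B \<alpha>. It therefore vanishes, and \<alpha> = A (B \<alpha>) = 0.\<close>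
  have "AE x in \<mu>. (\<Sum>p<N. (\<Sum>i<N. B $$ (p, i) * \<alpha> i) * f p x) = 0"
    using allB zero
  proof eventually_elim
    case (elim x)
    have "(\<Sum>p<N. (\<Sum>i<N. B $$ (p, i) * \<alpha> i) * f p x)
        = (\<Sum>p<N. \<Sum>i<N. \<alpha> i * (f p x * B $$ (p, i)))"
      unfolding sum_distrib_right by (simp add: mult_ac)
    also have "\<dots> = (\<Sum>i<N. \<Sum>p<N. \<alpha> i * (f p x * B $$ (p, i)))"
      by (rule sum.swap)
    also have "\<dots> = (\<Sum>i<N. \<alpha> i * y i x)"
      using elim by (simp add: comb_def sum_distrib_left)
    finally show ?case
      using elim by simp
  qed
  then have B\<alpha>: "(\<Sum>i<N. B $$ (p, i) * \<alpha> i) = 0" if "p < N" for p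
    by (rule L2_independentD[OF ind _ that])
  have "\<alpha> l = (\<Sum>i<N. (A * B) $$ (l, i) * \<alpha> i)"
  proof -
    have "(\<Sum>i<N. (A * B) $$ (l, i) * \<alpha> i) = (\<Sum>i<N. if i = l then \<alpha> i else 0)"
      unfolding AB using l by (intro sum.cong) auto
    then show ?thesis using l by simp
  qed
  also have "\<dots> = (\<Sum>i<N. \<Sum>p<N. A $$ (l, p) * (B $$ (p, i) * \<alpha> i))"
    using l by (simp add: index_mult_mat_sum[OF A(1) B(1)] sum_distrib_right mult.assoc del: index_mult_mat)
  also have "\<dots> = (\<Sum>p<N. \<Sum>i<N. A $$ (l, p) * (B $$ (p, i) * \<alpha> i))"
    by (rule sum.swap)
  also have "\<dots> = 0"
    by (simp add: sum_distrib_left[symmetric] B\<alpha>)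
  finally show "\<alpha> l = 0" .
qed

text \<open>A trivial kernel means a nonzero determinant. The lemma serves to invert the coordinate
  matrix \<open>L\<close> of the Krylov functions.\<close>

lemma inverse_of_trivial_kernel:
  fixes A :: "real mat"
  assumes A: "A \<in> carrier_mat N N"
    and ker: "\<And>v. v \<in> carrier_vec N \<Longrightarrow> A *\<^sub>v v = 0\<^sub>v N \<Longrightarrow> v = 0\<^sub>v N"
  obtains C where "C \<in> carrier_mat N N" "A * C = 1\<^sub>m N" "C * A = 1\<^sub>m N"
proof -
  have "Determinant.det A \<noteq> 0"
    using det_0_iff_vec_prod_zero_field[OF A] ker by blast
  from det_non_zero_imp_unit[OF A this, of "()"] that show thesis
    by (auto simp: Units_def ring_mat_def)
qed

section \<open>Powers and Chebyshev polynomials\<close>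

text \<open>Here \<open>S i k\<close> stands for a moment of $x^i T_k(x)$ and the recursion is
  $2 x T_{k+1} = T_{k+2} + T_k$. It avoids expanding powers and Chebyshev polynomials in each other.\<close>

lemma cheb_moments_iff:
  fixes S S' :: "nat \<Rightarrow> nat \<Rightarrow> real"
  assumes S: "\<And>i. S (Suc i) 0 = S i 1" "\<And>i k. 2 * S (Suc i) (Suc k) = S i (Suc (Suc k)) + S i k"
    and S': "\<And>i. S' (Suc i) 0 = S' i 1" "\<And>i k. 2 * S' (Suc i) (Suc k) = S' i (Suc (Suc k)) + S' i k"
  shows "(\<forall>k<N. S 0 k = S' 0 k) \<longleftrightarrow> (\<forall>i<N. S i 0 = S' i 0)"
proof
  assume eq: "\<forall>k<N. S 0 k = S' 0 k"
  \<comment> \<open>Lowering the power by one costs at most one Chebyshev degree: entry (i+1, k)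
    needs (i, k+1) and (i, k-1), which stay in the triangle where the index sum is below
    \<open>N\<close>.\<close>
  have "\<forall>k. i + k < N \<longrightarrow> S i k = S' i k" for i
  proof (induction i)
    case (Suc i)
    show ?case
    proof (intro allI impI)
      fix k assume k: "Suc i + k < N"
      show "S (Suc i) k = S' (Suc i) k"
      proof (cases k)
        case 0
        then show ?thesis using Suc k S(1) S'(1) by simp
      next
        case (Suc j)
        then have "S i (Suc (Suc j)) = S' i (Suc (Suc j))" "S i j = S' i j"
          using Suc.IH k by auto
        then show ?thesis using S(2)[of i j] S'(2)[of i j] Suc by simp
      qed
    qed
  qed (use eq in auto)
  then show "\<forall>i<N. S i 0 = S' i 0" by simp
next
  assume eq: "\<forall>i<N. S i 0 = S' i 0"
  \<comment> \<open>Now the degree is lowered: entry (i, k) needs (i+1, k-1) and (i, k-2), again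
    within the triangle. Two earlier degrees occur, hence strong induction.\<close>
  have "\<forall>i. i + k < N \<longrightarrow> S i k = S' i k" for k
  proof (induction k rule: less_induct)
    case (less k)
    show ?case
    proof (intro allI impI)
      fix i assume i: "i + k < N"
      consider "k = 0" | "k = 1" | j where "k = Suc (Suc j)"
        by (metis One_nat_def not0_implies_Suc)
      then show "S i k = S' i k"
      proof cases
        case 1
        then show ?thesis using eq i by simp
      next
        case 2
        then show ?thesis using eq i S(1)[of i] S'(1)[of i] by simp
      next
        case 3
        have "S (Suc i) (Suc j) = S' (Suc i) (Suc j)" "S i j = S' i j"
          using less[of "Suc j"] less[of j] i 3 by auto
        then show ?thesis using S(2)[of i j] S'(2)[of i j] 3 by simp
      qed
    qed
  qed
  from this[rule_format, of 0] show "\<forall>k<N. S 0 k = S' 0 k" by simp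
qed

section \<open>Matrix powers and moments of a matrix realization\<close>

lemma cheb_mat_carrier: "X \<in> carrier_mat N N \<Longrightarrow> cheb_mat k X \<in> carrier_mat N N"
  by (induction k X rule: cheb_mat.induct) auto

lemma pow_mat_add:
  assumes "X \<in> carrier_mat N N"
  shows "X ^\<^sub>m (i + j) = X ^\<^sub>m i * X ^\<^sub>m j"
proof (induction j)
  case 0
  then show ?case using assms by (simp add: right_mult_one_mat[of _ N N])
next
  case (Suc j)
  then show ?case using assms by (simp add: assoc_mult_mat[of _ N N _ N _ N])
qed

lemma transpose_pow_mat:
  fixes X :: "'r :: comm_semiring_1 mat"
  assumes X: "X \<in> carrier_mat N N" "transpose_mat X = X"
  shows "transpose_mat (X ^\<^sub>m i) = X ^\<^sub>m i"
proof (induction i)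
  case (Suc i)
  have "transpose_mat (X ^\<^sub>m Suc i) = X * X ^\<^sub>m i"
    using transpose_mult[of "X ^\<^sub>m i" N N X N] X Suc by simp
  also have "\<dots> = X ^\<^sub>m (1 + i)"
    using pow_mat_add[OF X(1), of 1 i] X by simp
  finally show ?case by simp
qed simp

text \<open>\<open>S p q i k\<close> stands for the operator moment b_p^* P^i T_k(P) b_q. Its matrix
  counterpart \<open>Z i k\<close> is Y^T X^i T_k(X) Y and obeys the same recursion, so
  \<open>cheb_moments_iff\<close> applies to each entry.\<close>

lemma interpolates_iff_power_moments:
  fixes S :: "nat \<Rightarrow> nat \<Rightarrow> nat \<Rightarrow> nat \<Rightarrow> real"
  assumes X: "X \<in> carrier_mat N N" and Y: "Y \<in> carrier_mat N m"
    and D: "\<And>k. D k = Matrix.mat m m (\<lambda>(p, q). S p q 0 k)"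
    and S: "\<And>p q i. p < m \<Longrightarrow> q < m \<Longrightarrow> S p q (Suc i) 0 = S p q i 1"
      "\<And>p q i k. p < m \<Longrightarrow> q < m \<Longrightarrow> 2 * S p q (Suc i) (Suc k) = S p q i (Suc (Suc k)) + S p q i k"
  shows "interpolates n D X Y \<longleftrightarrow>
    (\<forall>i<2 * n. \<forall>p<m. \<forall>q<m. (transpose_mat Y * (X ^\<^sub>m i * Y)) $$ (p, q) = S p q i 0)"
proof -
  define Z where "Z i k = transpose_mat Y * (X ^\<^sub>m i * (cheb_mat k X * Y))" for i k
  have Xi: "X ^\<^sub>m i \<in> carrier_mat N N" for i
    using X by simp
  have Tk: "cheb_mat k X \<in> carrier_mat N N" for k
    using X by (rule cheb_mat_carrier)
  have Z_carrier: "Z i k \<in> carrier_mat m m" for i k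
    unfolding Z_def using X Y by (intro mult_carrier_mat[of _ _ N] Xi Tk) auto
  have Z0: "Z i 0 = transpose_mat Y * (X ^\<^sub>m i * Y)" for i
    using X Y by (simp add: Z_def)
  have DZ: "Z 0 k = transpose_mat Y * cheb_mat k X * Y" for k
    using X Y Tk[of k] by (simp add: Z_def assoc_mult_mat[of _ m N _ N _ m] left_mult_one_mat[of _ N m])
  have Z_Suc: "Z (Suc i) k = transpose_mat Y * (X ^\<^sub>m i * ((X * cheb_mat k X) * Y))" for i k
  proof -
    have "X ^\<^sub>m Suc i * (cheb_mat k X * Y) = X ^\<^sub>m i * (X * (cheb_mat k X * Y))"
      unfolding pow_mat.simps using X Xi mult_carrier_mat[OF Tk Y] by (intro assoc_mult_mat[of _ N N _ N _ m]) auto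
    also have "X * (cheb_mat k X * Y) = (X * cheb_mat k X) * Y"
      using X Y Tk by (intro assoc_mult_mat[of _ N N _ N _ m, symmetric]) auto
    finally show ?thesis by (simp only: Z_def)
  qed
  have Z1: "Z (Suc i) 0 = Z i 1" for i
    unfolding Z_Suc by (simp add: Z_def X[THEN right_mult_one_mat] carrier_matD[OF X])
  \<comment> \<open>The recursion defining \<open>cheb_mat\<close> is multiplied by Y^T X^i on the
    left and by \<open>Y\<close> on the right; the extra factor \<open>X\<close> raises the power to
    \<open>Suc i\<close>.\<close>
  have Z2: "2 * Z (Suc i) (Suc k) $$ (p, q) = Z i (Suc (Suc k)) $$ (p, q) + Z i k $$ (p, q)"
    if pq: "p < m" "q < m" for i k p q
  proof -
    let ?W = "X * cheb_mat (Suc k) X"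
    have W: "?W \<in> carrier_mat N N"
      using X Tk by auto
    have "(2 \<cdot>\<^sub>m ?W - cheb_mat k X) * Y = 2 \<cdot>\<^sub>m (?W * Y) - cheb_mat k X * Y"
      using W Tk[of k] Y by (simp add: minus_mult_distrib_mat[of _ N N _ _ m] mult_smult_assoc_mat[of _ N N _ m])
    then have "X ^\<^sub>m i * (cheb_mat (Suc (Suc k)) X * Y)
        = X ^\<^sub>m i * (2 \<cdot>\<^sub>m (?W * Y)) - X ^\<^sub>m i * (cheb_mat k X * Y)"
      using W Tk[of k] Y Xi[of i] by (simp add: mult_minus_distrib_mat[of _ N N _ m])
    also have "X ^\<^sub>m i * (2 \<cdot>\<^sub>m (?W * Y)) = 2 \<cdot>\<^sub>m (X ^\<^sub>m i * (?W * Y))"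
      using W Y Xi[of i] by (intro mult_smult_distrib[of _ N N _ m]) auto
    finally have "Z i (Suc (Suc k))
        = transpose_mat Y * (2 \<cdot>\<^sub>m (X ^\<^sub>m i * (?W * Y))) - Z i k"
      using W Tk[of k] Y Xi[of i] by (simp add: Z_def mult_minus_distrib_mat[of _ m N _ m])
    also have "transpose_mat Y * (2 \<cdot>\<^sub>m (X ^\<^sub>m i * (?W * Y))) = 2 \<cdot>\<^sub>m Z (Suc i) (Suc k)"
      unfolding Z_Suc using W Y Xi[of i] by (intro mult_smult_distrib[of _ m N _ m]) auto
    finally show ?thesis
      using pq carrier_matD[OF Z_carrier[of "Suc i" "Suc k"]] carrier_matD[OF Z_carrier[of i k]] by simp
  qed
  have "D k = Z 0 k \<longleftrightarrow> (\<forall>p<m. \<forall>q<m. Z 0 k $$ (p, q) = S p q 0 k)" for k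
    using Z_carrier[of 0 k] by (auto simp: D mat_eq_iff)
  then have "interpolates n D X Y \<longleftrightarrow> (\<forall>p<m. \<forall>q<m. \<forall>k<2 * n. Z 0 k $$ (p, q) = S p q 0 k)"
    unfolding interpolates_def DZ[symmetric] by (simp only:) blast
  also have "\<dots> \<longleftrightarrow> (\<forall>p<m. \<forall>q<m. \<forall>i<2 * n. Z i 0 $$ (p, q) = S p q i 0)"
  proof -
    have "(\<forall>k<2 * n. Z 0 k $$ (p, q) = S p q 0 k) \<longleftrightarrow> (\<forall>i<2 * n. Z i 0 $$ (p, q) = S p q i 0)"
      if "p < m" "q < m" for p q
      using that by (intro cheb_moments_iff Z2 S) (simp_all only: Z1)
    then show ?thesis by simp
  qed
  finally show ?thesis
    unfolding Z0 by blast
qed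

section \<open>Functions of the operator\<close>

locale spectral_rep =
  fixes \<mu> :: "'x measure" and A :: "'x opgraph" and M :: "'s measure"
    and U :: "('x \<Rightarrow> real) \<Rightarrow> 's \<Rightarrow> real" and a :: "'s \<Rightarrow> real"
  assumes spectral: "spectral_representation \<mu> A M U a"
begin

lemma a_measurable: "a \<in> borel_measurable M"
  and U_L2: "f \<in> L2 \<mu> \<Longrightarrow> U f \<in> L2 M"
  and U_inner: "f \<in> L2 \<mu> \<Longrightarrow> g \<in> L2 \<mu> \<Longrightarrow> L2_inner \<mu> f g = L2_inner M (U f) (U g)"
  and U_surj: "h \<in> L2 M \<Longrightarrow> \<exists>f \<in> L2 \<mu>. AE z in M. U f z = h z"
  using spectral by (simp_all add: spectral_representation_def)

lemma multiplier_L2: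
  assumes "f \<in> borel_measurable borel" "\<And>l. \<bar>f l\<bar> \<le> C" "w \<in> L2 \<mu>"
  shows "(\<lambda>z. f (a z) * U w z) \<in> L2 M"
  using assms a_measurable by (intro L2_bounded_mult[where C = C] U_L2) auto

text \<open>Boundedness of \<open>f\<close> keeps the multiplied function square integrable, so
  surjectivity of \<open>U\<close> supplies a candidate for the choice made in
  \<open>op_fun\<close>.\<close>

lemma op_fun_spec:
  assumes "f \<in> borel_measurable borel" "\<And>l. \<bar>f l\<bar> \<le> C" "w \<in> L2 \<mu>"
  shows "op_fun \<mu> M U a f w \<in> L2 \<mu>"
    and "AE z in M. U (op_fun \<mu> M U a f w) z = f (a z) * U w z"
proof -
  have "\<exists>y. y \<in> L2 \<mu> \<and> (AE z in M. U y z = f (a z) * U w z)"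
    using U_surj[OF multiplier_L2[OF assms]] by blast
  from someI_ex[OF this] have "op_fun \<mu> M U a f w \<in> L2 \<mu> \<and>
      (AE z in M. U (op_fun \<mu> M U a f w) z = f (a z) * U w z)"
    unfolding op_fun_def .
  then show "op_fun \<mu> M U a f w \<in> L2 \<mu>"
    and "AE z in M. U (op_fun \<mu> M U a f w) z = f (a z) * U w z"
    by simp_all
qed

lemma inner_op_fun:
  assumes "f \<in> borel_measurable borel" "\<And>l. \<bar>f l\<bar> \<le> C" "w \<in> L2 \<mu>" "w' \<in> L2 \<mu>"
  shows "L2_inner \<mu> w' (op_fun \<mu> M U a f w) = L2_inner M (U w') (\<lambda>z. f (a z) * U w z)"
proof -
  note y = op_fun_spec[OF assms(1-3)]
  show ?thesis
    unfolding U_inner[OF assms(4) y(1)]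
    by (rule L2_inner_cong_AE[OF U_L2[OF y(1)] multiplier_L2[OF assms(1-3)] U_L2[OF assms(4)] y(2)])
qed

text \<open>Multiplication by a real function is symmetric in the spectral space, and
  \<open>U\<close> preserves inner products.\<close>

lemma op_fun_symmetric:
  assumes "f \<in> borel_measurable borel" "\<And>l. \<bar>f l\<bar> \<le> C" "w \<in> L2 \<mu>" "w' \<in> L2 \<mu>"
  shows "L2_inner \<mu> (op_fun \<mu> M U a f w) w' = L2_inner \<mu> w (op_fun \<mu> M U a f w')"
  using inner_op_fun[OF assms] inner_op_fun[OF assms(1,2,4,3)]
  by (simp add: L2_inner_commute[of \<mu> _ w'] L2_inner_real mult_ac)


text \<open>Since T_k(cos y) = cos (k y), this is the inner product of \<open>w\<close> with P^i
  T_k(P) w', where P = cos(\<tau> sqrt a) in the spectral representation.\<close>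

definition moment :: "real \<Rightarrow> ('x \<Rightarrow> real) \<Rightarrow> ('x \<Rightarrow> real) \<Rightarrow> nat \<Rightarrow> nat \<Rightarrow> real" where
  "moment \<tau> w w' i k = L2_inner M (U w)
     (\<lambda>z. cos (\<tau> * sqrt (a z)) ^ i * cos (real k * \<tau> * sqrt (a z)) * U w' z)"

text \<open>The second recursion is the identity 2 cos y cos((k+1) y) = cos((k+2) y) + cos(k y),
  integrated in the spectral variable.\<close>

lemma moment_rec:
  assumes "w \<in> L2 \<mu>" "w' \<in> L2 \<mu>"
  shows "moment \<tau> w w' (Suc i) 0 = moment \<tau> w w' i 1"
    and "2 * moment \<tau> w w' (Suc i) (Suc k) = moment \<tau> w w' i (Suc (Suc k)) + moment \<tau> w w' i k"
proof -
  show "moment \<tau> w w' (Suc i) 0 = moment \<tau> w w' i 1"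
    by (simp add: moment_def mult.commute)
  have cosb: "\<bar>cos x ^ i * cos y\<bar> \<le> 1" for x y :: real
    unfolding abs_mult power_abs by (intro mult_le_one power_le_one) auto
  \<comment> \<open>Integrability of each summand is what allows the integral of the sum to be
    split.\<close>
  have int: "integrable M (\<lambda>z. U w z * (cos (\<tau> * sqrt (a z)) ^ i * cos (real j * \<tau> * sqrt (a z)) * U w' z))" for j
    using assms cosb by (intro L2_mult_integrable U_L2
        multiplier_L2[of "\<lambda>l. cos (\<tau> * sqrt l) ^ i * cos (real j * \<tau> * sqrt l)" 1]) auto
  have trig: "2 * (cos y * cos (real (Suc k) * y)) = cos (real (Suc (Suc k)) * y) + cos (real k * y)" for y
    using cos_add[of "real (Suc k) * y" y] cos_diff[of "real (Suc k) * y" y] by (simp add: algebra_simps)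
  have "2 * (U w z * (cos (\<tau> * sqrt (a z)) ^ Suc i * cos (real (Suc k) * \<tau> * sqrt (a z)) * U w' z))
      = U w z * (cos (\<tau> * sqrt (a z)) ^ i * cos (real (Suc (Suc k)) * \<tau> * sqrt (a z)) * U w' z)
        + U w z * (cos (\<tau> * sqrt (a z)) ^ i * cos (real k * \<tau> * sqrt (a z)) * U w' z)" for z
  proof -
    have "2 * (U w z * (cos (\<tau> * sqrt (a z)) ^ Suc i * cos (real (Suc k) * \<tau> * sqrt (a z)) * U w' z))
      = U w z * cos (\<tau> * sqrt (a z)) ^ i * U w' z
        * (2 * (cos (\<tau> * sqrt (a z)) * cos (real (Suc k) * (\<tau> * sqrt (a z)))))"
      by (simp only: power_Suc mult_ac)
    also have "\<dots> = U w z * cos (\<tau> * sqrt (a z)) ^ i * U w' z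
        * (cos (real (Suc (Suc k)) * (\<tau> * sqrt (a z))) + cos (real k * (\<tau> * sqrt (a z))))"
      by (simp only: trig)
    finally show ?thesis
      by (simp only: distrib_left mult_ac)
  qed
  then have "2 * moment \<tau> w w' (Suc i) (Suc k)
      = (LINT z|M. U w z * (cos (\<tau> * sqrt (a z)) ^ i * cos (real (Suc (Suc k)) * \<tau> * sqrt (a z)) * U w' z)
        + U w z * (cos (\<tau> * sqrt (a z)) ^ i * cos (real k * \<tau> * sqrt (a z)) * U w' z))"
    by (simp only: moment_def L2_inner_real integral_mult_right_zero[symmetric])
  also have "\<dots> = moment \<tau> w w' i (Suc (Suc k)) + moment \<tau> w w' i k"
    unfolding moment_def L2_inner_real by (rule Bochner_Integration.integral_add[OF int int])
  finally show "2 * moment \<tau> w w' (Suc i) (Suc k)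
      = moment \<tau> w w' i (Suc (Suc k)) + moment \<tau> w w' i k" .
qed

lemma propagator_power:
  assumes "w \<in> L2 \<mu>"
  shows "(op_fun \<mu> M U a (\<lambda>l. cos (\<tau> * sqrt l)) ^^ i) w \<in> L2 \<mu> \<and>
    (AE z in M. U ((op_fun \<mu> M U a (\<lambda>l. cos (\<tau> * sqrt l)) ^^ i) w) z = cos (\<tau> * sqrt (a z)) ^ i * U w z)"
proof (induction i)
  case (Suc i)
  note y = op_fun_spec[of "\<lambda>l. cos (\<tau> * sqrt l)" 1, OF _ _ conjunct1[OF Suc]]
  have 1: "(op_fun \<mu> M U a (\<lambda>l. cos (\<tau> * sqrt l)) ^^ Suc i) w \<in> L2 \<mu>"
    using y(1) by simp
  have "AE z in M. U ((op_fun \<mu> M U a (\<lambda>l. cos (\<tau> * sqrt l)) ^^ Suc i) w) z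
      = cos (\<tau> * sqrt (a z)) * U ((op_fun \<mu> M U a (\<lambda>l. cos (\<tau> * sqrt l)) ^^ i) w) z"
    using y(2) by simp
  with conjunct2[OF Suc] have "AE z in M. U ((op_fun \<mu> M U a (\<lambda>l. cos (\<tau> * sqrt l)) ^^ Suc i) w) z
      = cos (\<tau> * sqrt (a z)) ^ Suc i * U w z"
    by eventually_elim simp
  with 1 show ?case by blast
qed (use assms in simp)

text \<open>The moments with Chebyshev degree 0 are the power moments;
  \<open>inner_cos_op_fun\<close> identifies those with power 0 as the sampled data. These are the
  two edges compared by \<open>cheb_moments_iff\<close>.\<close>

lemma inner_propagator_power:
  assumes "w \<in> L2 \<mu>" "w' \<in> L2 \<mu>"
  shows "L2_inner \<mu> w ((op_fun \<mu> M U a (\<lambda>l. cos (\<tau> * sqrt l)) ^^ i) w') = moment \<tau> w w' i 0"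
proof -
  note y = propagator_power[OF assms(2), where \<tau> = \<tau> and i = i]
  have b: "\<bar>cos x ^ i\<bar> \<le> 1" for x :: real
    unfolding power_abs by (intro power_le_one) auto
  have m: "(\<lambda>z. cos (\<tau> * sqrt (a z)) ^ i * U w' z) \<in> L2 M"
    using multiplier_L2[of "\<lambda>l. cos (\<tau> * sqrt l) ^ i" 1, OF _ b assms(2)] by simp
  show ?thesis
    unfolding moment_def U_inner[OF assms(1) conjunct1[OF y]]
    using L2_inner_cong_AE[OF U_L2[OF conjunct1[OF y]] m U_L2[OF assms(1)] conjunct2[OF y]] by simp
qed

lemma inner_cos_op_fun:
  assumes "w \<in> L2 \<mu>" "w' \<in> L2 \<mu>"
  shows "L2_inner \<mu> w (op_fun \<mu> M U a (\<lambda>l. cos (real k * \<tau> * sqrt l)) w') = moment \<tau> w w' 0 k"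
  using inner_op_fun[of "\<lambda>l. cos (real k * \<tau> * sqrt l)" 1 w' w] assms by (simp add: moment_def)

end

section \<open>Projection of a symmetric operator on a block Krylov subspace\<close>

text \<open>Combinations inside \<open>P\<close> are handled weakly: symmetry moves \<open>P\<close>
  to the other factor of the inner product, and the combination is expanded there.\<close>

locale symmetric_operator =
  fixes \<mu> :: "'x measure" and P :: "('x \<Rightarrow> real) \<Rightarrow> ('x \<Rightarrow> real)"
  assumes L2_closed: "w \<in> L2 \<mu> \<Longrightarrow> P w \<in> L2 \<mu>"
    and symmetric: "w \<in> L2 \<mu> \<Longrightarrow> w' \<in> L2 \<mu> \<Longrightarrow> L2_inner \<mu> (P w) w' = L2_inner \<mu> w (P w')"
begin

lemma power_L2: "w \<in> L2 \<mu> \<Longrightarrow> (P ^^ i) w \<in> L2 \<mu>"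
  by (induction i) (auto intro: L2_closed)

lemma power_symmetric:
  assumes "w \<in> L2 \<mu>" "w' \<in> L2 \<mu>"
  shows "L2_inner \<mu> ((P ^^ i) w) w' = L2_inner \<mu> w ((P ^^ i) w')"
  using assms(2)
proof (induction i arbitrary: w')
  case (Suc i)
  then show ?case
    using assms(1) Suc.IH[OF L2_closed[OF Suc.prems]]
    by (simp add: symmetric power_L2 L2_closed funpow_swap1[symmetric])
qed simp

text \<open>The block Hankel property: inner products of Krylov functions depend only on the sum of
  the powers.\<close>

lemma inner_powers:
  assumes "w \<in> L2 \<mu>" "w' \<in> L2 \<mu>"
  shows "L2_inner \<mu> ((P ^^ i) w) ((P ^^ j) w') = L2_inner \<mu> w ((P ^^ (i + j)) w')"
  using power_symmetric[OF assms(1) power_L2[OF assms(2)]] by (simp add: funpow_add)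

lemma projection_moments:
  assumes V: "\<And>i. i < N \<Longrightarrow> V i \<in> L2 \<mu>" "star \<mu> N N V V = 1\<^sub>m N"
    and b: "\<And>j. j < m \<Longrightarrow> b j \<in> L2 \<mu>"
    and span: "\<And>k j. k < n \<Longrightarrow> j < m \<Longrightarrow> (P ^^ k) (b j) \<in> L2_span \<mu> N V"
    and i: "i < 2 * n" and pq: "p < m" "q < m"
  defines "X \<equiv> star \<mu> N N V (\<lambda>i. P (V i))" and "Y \<equiv> star \<mu> N m V b"
  shows "(transpose_mat Y * (X ^\<^sub>m i * Y)) $$ (p, q) = L2_inner \<mu> (b p) ((P ^^ i) (b q))"
proof -
  define Q where "Q k = star \<mu> N m V (\<lambda>j. (P ^^ k) (b j))" for k
  have Pb: "(P ^^ k) (b j) \<in> L2 \<mu>" if "j < m" for k j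
    using b[OF that] by (rule power_L2)
  have X: "X \<in> carrier_mat N N" and Y: "Y \<in> carrier_mat N m" and Q: "Q k \<in> carrier_mat N m" for k
    by (simp_all add: X_def Y_def Q_def)
  have sym: "transpose_mat X = X"
    unfolding X_def star_transpose using V(1) by (intro star_cong symmetric)
  \<comment> \<open>Orthonormality identifies the unknown coefficients \<open>R\<close> with the
    projections \<open>Q k\<close>.\<close>
  have comb_Q: "AE x in \<mu>. (P ^^ k) (b j) x = comb N V (Q k) j x" if k: "k < n" and j: "j < m" for k j
  proof -
    obtain R where R: "R \<in> carrier_mat N m"
      "\<And>j. j < m \<Longrightarrow> AE x in \<mu>. (P ^^ k) (b j) x = comb N V R j x"
      using L2_span_comb_matrix[of m "\<lambda>j. (P ^^ k) (b j)", OF span[OF k]] by blast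
    have "Q k = star \<mu> N N V V * R"
      unfolding Q_def by (rule star_comb_right) (use V Pb R in auto)
    then have "Q k = R"
      using V(2) R(1) by simp
    then show ?thesis
      using R(2)[OF j] by simp
  qed
  \<comment> \<open>\<open>P\<close> is moved onto \<open>V\<close>, so only P^k b, not P^(k+1) b,
    has to lie in the span. This carries the identity for \<open>Q\<close> up to k = n, one step
    beyond the subspace.\<close>
  have Q_Suc: "Q (Suc k) = X * Q k" if k: "k < n" for k
  proof -
    have "Q (Suc k) = star \<mu> N m (\<lambda>i. P (V i)) (\<lambda>j. (P ^^ k) (b j))"
      unfolding Q_def using V(1) Pb by (intro star_cong) (simp add: symmetric)
    also have "\<dots> = star \<mu> N N (\<lambda>i. P (V i)) V * Q k"
      by (rule star_comb_right) (use V Pb Q comb_Q[OF k] L2_closed in auto)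
    also have "star \<mu> N N (\<lambda>i. P (V i)) V = X"
      using sym unfolding X_def star_transpose .
    finally show ?thesis .
  qed
  have Q_pow: "X ^\<^sub>m k * Y = Q k" if "k \<le> n" for k
    using that
  proof (induction k)
    case 0
    then show ?case using X Y by (simp add: Q_def Y_def)
  next
    case (Suc k)
    have "X ^\<^sub>m Suc k * Y = (X * X ^\<^sub>m k) * Y"
      using pow_mat_add[OF X, of 1 k] X by simp
    also have "\<dots> = X * (X ^\<^sub>m k * Y)"
      using X Y by (intro assoc_mult_mat[of _ N N _ N _ m]) auto
    finally show ?case
      using Suc by (simp add: Q_Suc)
  qed
  \<comment> \<open>The left factor is expanded in \<open>V\<close>, which requires i1 < n; the
    right factor is only projected, so j1 = n is allowed. This reaches i = 2n-1.\<close>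
  define i1 where "i1 = min i (n - 1)"
  define j1 where "j1 = i - i1"
  have ij: "i = i1 + j1" "i1 < n" "j1 \<le> n"
    using i by (auto simp: i1_def j1_def)
  have "X ^\<^sub>m i * Y = X ^\<^sub>m i1 * (X ^\<^sub>m j1 * Y)"
    unfolding ij(1) pow_mat_add[OF X] using X Y by (intro assoc_mult_mat[of _ N N _ N _ m]) auto
  then have "transpose_mat Y * (X ^\<^sub>m i * Y) = (transpose_mat Y * X ^\<^sub>m i1) * (X ^\<^sub>m j1 * Y)"
    using X Y by (simp add: assoc_mult_mat[of "transpose_mat Y" m N _ N _ m] mult_carrier_mat[of _ N N])
  also have "transpose_mat Y * X ^\<^sub>m i1 = transpose_mat (X ^\<^sub>m i1 * Y)"
    using X Y by (simp add: transpose_mult[of _ N N _ m] transpose_pow_mat[OF X sym])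
  also have "transpose_mat (X ^\<^sub>m i1 * Y) * (X ^\<^sub>m j1 * Y)
      = transpose_mat (Q i1) * star \<mu> N m V (\<lambda>j. (P ^^ j1) (b j))"
    using ij Q_pow[of i1] Q_pow[of j1] by (simp add: Q_def)
  also have "\<dots> = star \<mu> m m (\<lambda>j. (P ^^ i1) (b j)) (\<lambda>j. (P ^^ j1) (b j))"
    by (rule star_comb_left[symmetric]) (use V Pb Q comb_Q[OF ij(2)] in auto)
  finally show ?thesis
    using pq b by (simp add: inner_powers ij(1))
qed


text \<open>\<open>L\<close> holds the would-be coordinates of the Krylov functions. Equal Gram
  matrices, without and with one factor \<open>P\<close>, let \<open>V\<close> be read off from
  \<open>K\<close> by inverting \<open>L\<close>.\<close>

lemma realization_is_projection:
  fixes m n :: nat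
  assumes m: "0 < m" and b: "\<And>j. j < m \<Longrightarrow> b j \<in> L2 \<mu>"
    and X: "X \<in> carrier_mat (m * n) (m * n)" "transpose_mat X = X" and Y: "Y \<in> carrier_mat (m * n) m"
    and n: "0 < n"
    and moments: "\<And>i p q. i < 2 * n \<Longrightarrow> p < m \<Longrightarrow> q < m \<Longrightarrow>
      (transpose_mat Y * (X ^\<^sub>m i * Y)) $$ (p, q) = L2_inner \<mu> (b p) ((P ^^ i) (b q))"
  defines "K \<equiv> blocks m (\<lambda>k j. (P ^^ k) (b j))"
  assumes ind: "L2_independent \<mu> (m * n) K"
  shows "\<exists>V. (\<forall>i<m * n. V i \<in> L2 \<mu>) \<and> star \<mu> (m * n) (m * n) V V = 1\<^sub>m (m * n) \<and>
    L2_span \<mu> (m * n) V = L2_span \<mu> (m * n) K \<and>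
    X = star \<mu> (m * n) (m * n) V (\<lambda>i. P (V i)) \<and> Y = star \<mu> (m * n) m V b"
proof -
  define N where "N = m * n"
  note X = X[folded N_def] and Y = Y[folded N_def] and ind = ind[folded N_def]
  have K_L2: "K i \<in> L2 \<mu>" for i
    unfolding K_def blocks_def using m b by (intro power_L2) simp
  have div: "c div m < n" "c mod m < m" if "c < N" for c
    using that m by (auto simp: N_def less_mult_imp_div_less mult.commute)
  have XkY: "X ^\<^sub>m k * Y \<in> carrier_mat N m" for k
    using pow_carrier_mat[OF X(1)] Y by (rule mult_carrier_mat)
  \<comment> \<open>Columns are ordered as in \<open>K\<close>: column \<open>c\<close> is column
    \<open>c mod m\<close> of block \<open>c div m\<close>.\<close>
  define L where "L = Matrix.mat N N (\<lambda>(r, c). (X ^\<^sub>m (c div m) * Y) $$ (r, c mod m))"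
  have L: "L \<in> carrier_mat N N"
    by (simp add: L_def)
  have XL: "(X ^\<^sub>m e * L) $$ (r, c) = (X ^\<^sub>m (e + c div m) * Y) $$ (r, c mod m)"
    if "r < N" "c < N" for e r c
  proof -
    have "(X ^\<^sub>m e * L) $$ (r, c) = (\<Sum>s<N. (X ^\<^sub>m e) $$ (r, s) * (X ^\<^sub>m (c div m) * Y) $$ (s, c mod m))"
      using that X L by (subst index_mult_mat_sum[of _ N N _ N]) (auto simp: L_def simp del: index_mult_mat)
    also have "\<dots> = (X ^\<^sub>m e * (X ^\<^sub>m (c div m) * Y)) $$ (r, c mod m)"
      using that X XkY div by (subst index_mult_mat_sum[of _ N N _ m]) auto
    also have "X ^\<^sub>m e * (X ^\<^sub>m (c div m) * Y) = X ^\<^sub>m (e + c div m) * Y"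
      unfolding pow_mat_add[OF X(1)] using X Y by (intro assoc_mult_mat[of _ N N _ N _ m, symmetric]) auto
    finally show ?thesis .
  qed
  have moments': "(\<Sum>r<N. (X ^\<^sub>m i * Y) $$ (r, p) * (X ^\<^sub>m j * Y) $$ (r, q))
      = L2_inner \<mu> (b p) ((P ^^ (i + j)) (b q))"
    if ij: "i + j < 2 * n" and pq: "p < m" "q < m" for i j p q
  proof -
    have "(\<Sum>r<N. (X ^\<^sub>m i * Y) $$ (r, p) * (X ^\<^sub>m j * Y) $$ (r, q))
        = (\<Sum>r<N. transpose_mat (X ^\<^sub>m i * Y) $$ (p, r) * (X ^\<^sub>m j * Y) $$ (r, q))"
      using pq X Y XkY[of i] by (intro sum.cong refl arg_cong2[where f = "(*)"]) (auto simp del: index_mult_mat(1))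
    also have "\<dots> = (transpose_mat (X ^\<^sub>m i * Y) * (X ^\<^sub>m j * Y)) $$ (p, q)"
      using pq by (intro index_mult_mat_sum[symmetric, of _ m N _ m] XkY transpose_carrier_mat[THEN iffD2])
    also have "transpose_mat (X ^\<^sub>m i * Y) = transpose_mat Y * X ^\<^sub>m i"
      using X Y by (simp add: transpose_mult[of _ N N _ m] transpose_pow_mat[OF X])
    also have "\<dots> * (X ^\<^sub>m j * Y) = transpose_mat Y * (X ^\<^sub>m i * (X ^\<^sub>m j * Y))"
      using X Y XkY by (intro assoc_mult_mat[of _ m N _ N _ m]) auto
    also have "X ^\<^sub>m i * (X ^\<^sub>m j * Y) = X ^\<^sub>m (i + j) * Y"
      unfolding pow_mat_add[OF X(1)] using X Y by (intro assoc_mult_mat[of _ N N _ N _ m, symmetric]) auto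
    finally show ?thesis
      using moments[OF ij pq] by simp
  qed
  have L_index: "L $$ (r, c) = (X ^\<^sub>m (c div m) * Y) $$ (r, c mod m)" if "r < N" "c < N" for r c
    using that by (simp add: L_def del: index_mult_mat)
  \<comment> \<open>The case e = 0 gives the Gram matrix and e = 1 the one with \<open>P\<close>.
    Block indices are at most n-1, so the total power is at most 2n-1, the last known
    moment.\<close>
  have gram: "transpose_mat L * (X ^\<^sub>m e * L) = star \<mu> N N K (\<lambda>i. (P ^^ e) (K i))" if e: "e \<le> 1" for e
  proof (rule eq_matI)
    fix c d assume "c < dim_row (star \<mu> N N K (\<lambda>i. (P ^^ e) (K i)))" "d < dim_col (star \<mu> N N K (\<lambda>i. (P ^^ e) (K i)))"
    then have cd: "c < N" "d < N" by simp_all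
    have XeL: "X ^\<^sub>m e * L \<in> carrier_mat N N"
      using pow_carrier_mat[OF X(1)] L by (rule mult_carrier_mat)
    have "(transpose_mat L * (X ^\<^sub>m e * L)) $$ (c, d) = (\<Sum>r<N. transpose_mat L $$ (c, r) * (X ^\<^sub>m e * L) $$ (r, d))"
      using L by (intro index_mult_mat_sum[OF _ XeL _ cd(2), of _ N] cd(1)) simp
    also have "\<dots> = (\<Sum>r<N. (X ^\<^sub>m (c div m) * Y) $$ (r, c mod m) * (X ^\<^sub>m (e + d div m) * Y) $$ (r, d mod m))"
    proof (intro sum.cong refl arg_cong2[where f = "(*)"])
      fix r assume "r \<in> {..<N}"
      then have r: "r < N" by simp
      show "transpose_mat L $$ (c, r) = (X ^\<^sub>m (c div m) * Y) $$ (r, c mod m)"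
        using L_index[OF r cd(1)] L r cd(1) by (simp del: index_mult_mat)
      show "(X ^\<^sub>m e * L) $$ (r, d) = (X ^\<^sub>m (e + d div m) * Y) $$ (r, d mod m)"
        by (rule XL[OF r cd(2)])
    qed
    also have "\<dots> = L2_inner \<mu> (b (c mod m)) ((P ^^ (c div m + (e + d div m))) (b (d mod m)))"
      using div[OF cd(1)] div[OF cd(2)] e by (intro moments') auto
    also have "\<dots> = L2_inner \<mu> (K c) ((P ^^ e) (K d))"
      using inner_powers[OF b[OF div(2)[OF cd(1)]] b[OF div(2)[OF cd(2)]], of "c div m" "e + d div m"]
      by (simp add: K_def blocks_def funpow_add)
    finally show "(transpose_mat L * (X ^\<^sub>m e * L)) $$ (c, d) = star \<mu> N N K (\<lambda>i. (P ^^ e) (K i)) $$ (c, d)"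
      using cd by simp
  qed (use X L in auto)
  have gram0: "transpose_mat L * L = star \<mu> N N K K"
    using gram[of 0] X L by simp
  have gramb: "transpose_mat L * Y = star \<mu> N m K b"
  proof (rule eq_matI)
    fix c q assume "c < dim_row (star \<mu> N m K b)" "q < dim_col (star \<mu> N m K b)"
    then have cq: "c < N" "q < m" by simp_all
    have "(transpose_mat L * Y) $$ (c, q) = (\<Sum>r<N. transpose_mat L $$ (c, r) * Y $$ (r, q))"
      using L Y cq by (intro index_mult_mat_sum[of _ N N _ m]) auto
    \<comment> \<open>The trivial power of \<open>X\<close> brings the sum into the form required by
      \<open>moments'\<close>.\<close>
    also have "\<dots> = (\<Sum>r<N. (X ^\<^sub>m (c div m) * Y) $$ (r, c mod m) * (X ^\<^sub>m 0 * Y) $$ (r, q))"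
    proof (intro sum.cong refl arg_cong2[where f = "(*)"])
      fix r assume "r \<in> {..<N}"
      then have r: "r < N" by simp
      show "transpose_mat L $$ (c, r) = (X ^\<^sub>m (c div m) * Y) $$ (r, c mod m)"
        using L_index[OF r cq(1)] L r cq(1) by (simp del: index_mult_mat)
      have "X ^\<^sub>m 0 * Y = Y"
        using X Y by simp
      then show "Y $$ (r, q) = (X ^\<^sub>m 0 * Y) $$ (r, q)"
        by (rule arg_cong[symmetric])
    qed
    also have "\<dots> = L2_inner \<mu> (b (c mod m)) ((P ^^ (c div m + 0)) (b q))"
      using div[OF cq(1)] cq by (intro moments') auto
    also have "\<dots> = L2_inner \<mu> (K c) (b q)"
      using inner_powers[OF b[OF div(2)[OF cq(1)]] b[OF cq(2)], of "c div m" 0]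
      by (simp add: K_def blocks_def)
    finally show "(transpose_mat L * Y) $$ (c, q) = star \<mu> N m K b $$ (c, q)"
      using cq by simp
  qed (use Y L in auto)
  \<comment> \<open>If L v = 0, then the function w = K v has squared norm v^T L^T L v = 0, and
    independence of \<open>K\<close> gives v = 0. Writing \<open>v\<close> as the one-column matrix
    \<open>C\<close> makes the rules for \<open>star\<close> applicable.\<close>
  have "v = 0\<^sub>v N" if v: "v \<in> carrier_vec N" and Lv: "L *\<^sub>v v = 0\<^sub>v N" for v
  proof -
    define C where "C = Matrix.mat N 1 (\<lambda>(i, j). vec_index v i)"
    have C: "C \<in> carrier_mat N 1"
      by (simp add: C_def)
    have LC: "L * C = 0\<^sub>m N 1"
    proof (rule eq_matI)
      fix r c assume "r < dim_row (0\<^sub>m N 1 :: real mat)" "c < dim_col (0\<^sub>m N 1 :: real mat)"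
      then have rc: "r < N" "c = 0" by simp_all
      have "Matrix.col C 0 = v"
        using v by (intro eq_vecI) (auto simp: C_def)
      then have "(L * C) $$ (r, c) = vec_index (L *\<^sub>v v) r"
        using rc L C by simp
      then show "(L * C) $$ (r, c) = 0\<^sub>m N 1 $$ (r, c)"
        using rc Lv by simp
    qed (use L C in auto)
    define w where "w = comb N K C 0"
    have w: "w \<in> L2 \<mu>"
      unfolding w_def by (rule comb_L2) (rule K_L2)
    have "star \<mu> 1 1 (\<lambda>i. w) (\<lambda>i. w) = transpose_mat C * star \<mu> N 1 K (\<lambda>i. w)"
      by (rule star_comb_left) (use w K_L2 C in \<open>auto simp: w_def\<close>)
    also have "star \<mu> N 1 K (\<lambda>i. w) = star \<mu> N N K K * C"
      by (rule star_comb_right) (use w K_L2 C in \<open>auto simp: w_def\<close>)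
    also have "\<dots> = transpose_mat L * (L * C)"
      unfolding gram0[symmetric] using L C by (intro assoc_mult_mat[of _ N N _ N _ 1]) auto
    also have "transpose_mat C * \<dots> = 0\<^sub>m 1 1"
      unfolding LC using L C by (simp add: right_mult_zero_mat[of _ _ N])
    finally have "star \<mu> 1 1 (\<lambda>i. w) (\<lambda>i. w) $$ (0, 0) = 0\<^sub>m 1 1 $$ (0, 0)"
      by (rule arg_cong)
    then have "AE x in \<mu>. w x = 0"
      using L2_inner_self_eq_0[OF w] by simp
    then have "AE x in \<mu>. (\<Sum>i<N. vec_index v i * K i x) = 0"
      by (simp add: w_def comb_def C_def mult.commute)
    then have "vec_index v i = 0" if "i < N" for i
      using that by (rule L2_independentD[OF ind])
    then show ?thesis
      using v by (intro eq_vecI) auto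
  qed
  then obtain C where C: "C \<in> carrier_mat N N" "L * C = 1\<^sub>m N" "C * L = 1\<^sub>m N"
    using inverse_of_trivial_kernel[OF L] by metis
  define V where "V = comb N K C"
  have V_L2: "V i \<in> L2 \<mu>" for i
    unfolding V_def by (rule comb_L2) (rule K_L2)
  have CL: "transpose_mat C * transpose_mat L = 1\<^sub>m N"
    using transpose_mult[OF L C(1)] C(2) by simp
  \<comment> \<open>With C the inverse of \<open>L\<close>, V^* P^e V = C^T (L^T X^e L) C = X^e. The
    case e = 0 is orthonormality of \<open>V\<close>, and e = 1 recovers \<open>X\<close>.\<close>
  have star_V: "star \<mu> N N V (\<lambda>i. (P ^^ e) (V i)) = X ^\<^sub>m e" if e: "e \<le> 1" for e
  proof -
    have PK: "(P ^^ e) (K i) \<in> L2 \<mu>" and PV: "(P ^^ e) (V i) \<in> L2 \<mu>" for i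
      using K_L2 V_L2 by (auto intro: power_L2)
    have "star \<mu> N N V (\<lambda>i. (P ^^ e) (V i)) = transpose_mat C * star \<mu> N N K (\<lambda>i. (P ^^ e) (V i))"
      by (rule star_comb_left) (use K_L2 V_L2 PV C in \<open>auto simp: V_def\<close>)
    \<comment> \<open>The power of \<open>P\<close> passes to \<open>K\<close> so that
      \<open>V\<close> can be expanded, and afterwards it returns to the right factor to match
      \<open>gram\<close>.\<close>
    also have "star \<mu> N N K (\<lambda>i. (P ^^ e) (V i)) = star \<mu> N N (\<lambda>i. (P ^^ e) (K i)) V"
      by (intro star_cong power_symmetric[symmetric] K_L2 V_L2)
    also have "\<dots> = star \<mu> N N (\<lambda>i. (P ^^ e) (K i)) K * C"
      by (rule star_comb_right) (use K_L2 V_L2 PK C in \<open>auto simp: V_def\<close>)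
    also have "star \<mu> N N (\<lambda>i. (P ^^ e) (K i)) K = star \<mu> N N K (\<lambda>i. (P ^^ e) (K i))"
      by (intro star_cong power_symmetric K_L2)
    also have "\<dots> = transpose_mat L * (X ^\<^sub>m e * L)"
      using gram[OF e] by simp
    also have "\<dots> * C = transpose_mat L * (X ^\<^sub>m e * L * C)"
      using X L C by (intro assoc_mult_mat[of _ N N _ N _ N]) auto
    also have "X ^\<^sub>m e * L * C = X ^\<^sub>m e * (L * C)"
      using X L C by (intro assoc_mult_mat[of _ N N _ N _ N]) auto
    also have "\<dots> = X ^\<^sub>m e"
      using X C(2) by (simp add: right_mult_one_mat[of _ N N])
    also have "transpose_mat C * (transpose_mat L * X ^\<^sub>m e) = (transpose_mat C * transpose_mat L) * X ^\<^sub>m e"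
      using X L C by (intro assoc_mult_mat[of _ N N _ N _ N, symmetric]) auto
    also have "\<dots> = X ^\<^sub>m e"
      using X by (simp add: CL left_mult_one_mat[of _ N N])
    finally show ?thesis .
  qed
  have "star \<mu> N m V b = transpose_mat C * star \<mu> N m K b"
    by (rule star_comb_left) (use K_L2 V_L2 b C in \<open>auto simp: V_def\<close>)
  also have "\<dots> = (transpose_mat C * transpose_mat L) * Y"
    unfolding gramb[symmetric] using L C Y by (intro assoc_mult_mat[of _ N N _ N _ m, symmetric]) auto
  also have "\<dots> = Y"
    using Y by (simp add: CL)
  finally have "star \<mu> N m V b = Y" .
  moreover have "star \<mu> N N V V = 1\<^sub>m N"
    using star_V[of 0] X by simp
  moreover have "star \<mu> N N V (\<lambda>i. P (V i)) = X"
    using star_V[of 1] X by simp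
  moreover have "L2_span \<mu> N V = L2_span \<mu> N K"
    unfolding V_def by (rule comb_inverse_span[OF C(1) L C(3)])
  ultimately show ?thesis
    using V_L2 unfolding N_def by (intro exI[of _ V]) simp
qed

end

section \<open>Both directions of the interpolation problem for the wave operator\<close>

lemma blocks_surj: "blocks m (\<lambda>k j. V (k * m + j)) = V"
  by (rule ext) (simp add: blocks_def)

text \<open>The symmetry imposed on \<open>Pt\<close> is forced by the desired form, since V^* P V
  is symmetric. The basis in the converse depends on the solution: conjugating a solution by an
  orthogonal matrix rotates the basis accordingly.\<close>

theorem lemma4p1:
  fixes \<Omega> B\<^sub>A B\<^sub>I :: "'a::euclidean_space set"
    and c \<theta> :: "'a \<Rightarrow> real"
    and \<mu> :: "'a measure"
    and M :: "'s measure" and U :: "('a \<Rightarrow> real) \<Rightarrow> 's \<Rightarrow> real" and a :: "'s \<Rightarrow> real"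
    and q :: "real \<Rightarrow> real"
    and m n :: nat and \<tau> :: real
    and S :: "nat \<Rightarrow> 'a set" and b :: "nat \<Rightarrow> 'a \<Rightarrow> real"
    and P :: "('a \<Rightarrow> real) \<Rightarrow> ('a \<Rightarrow> real)"
    and D :: "nat \<Rightarrow> real mat"
  assumes dimension: "DIM('a) = 2 \<or> DIM('a) = 3"
    and domain: "open \<Omega>" "connected \<Omega>" "bounded \<Omega>" "\<Omega> \<noteq> {}"
    and boundary: "B\<^sub>A \<subseteq> frontier \<Omega>" "B\<^sub>I = frontier \<Omega> - B\<^sub>A"
    and velocity: "piecewise_smooth \<Omega> c" "\<exists>c\<^sub>0>0. \<forall>x\<in>\<Omega>. c\<^sub>0 \<le> c x"
    and mu: "\<mu> = lebesgue_on \<Omega>"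
    and self_adjoint: "self_adjoint \<mu> (A_hat \<Omega> B\<^sub>I c)"
    and spectral: "spectral_representation \<mu> (neg_graph (A_hat \<Omega> B\<^sub>I c)) M U a"
    and wavelet: "\<forall>t. q (- t) = q t" "continuous_on UNIV q" "integrable lborel q"
      "\<forall>s. 0 \<le> q_tilde q (s\<^sup>2)"
    and counts: "0 < m" "0 < n" "0 < \<tau>"
    and supports: "\<forall>j<m. compact (S j) \<and> S j \<noteq> {} \<and> S j \<subseteq> B\<^sub>A" "disjoint_family_on S {..<m}"
    and theta: "\<forall>j<m. set_integrable surface_measure (S j) \<theta>"
    and transducers:
      "\<forall>j<m. is_op_fun_surface \<Omega> (op_fun \<mu> M U a (\<lambda>l. sqrt (q_tilde q l))) \<theta> (S j) (b j)"
    and propagator: "P = op_fun \<mu> M U a (\<lambda>l. cos (\<tau> * sqrt l))"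
    and data: "\<forall>k. D k = star \<mu> m m b (\<lambda>j. op_fun \<mu> M U a (\<lambda>l. cos (real k * \<tau> * sqrt l)) (b j))"
    and krylov_dim: "has_L2_dim \<mu> (krylov \<mu> m n P b) (m * n)"
  shows
    "(\<forall>v. orthonormal_basis \<mu> (m * n) (blocks m v) (krylov \<mu> m n P b) \<longrightarrow>
        interpolates n D
          (star \<mu> (m * n) (m * n) (blocks m v) (\<lambda>i. P (blocks m v i)))
          (star \<mu> (m * n) m (blocks m v) b)) \<and>
     (\<forall>Pt Bt. Pt \<in> carrier_mat (m * n) (m * n) \<and> Bt \<in> carrier_mat (m * n) m \<and>
        transpose_mat Pt = Pt \<and> interpolates n D Pt Bt \<longrightarrow>
        (\<exists>v. orthonormal_basis \<mu> (m * n) (blocks m v) (krylov \<mu> m n P b) \<and>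
             Pt = star \<mu> (m * n) (m * n) (blocks m v) (\<lambda>i. P (blocks m v i)) \<and>
             Bt = star \<mu> (m * n) m (blocks m v) b))"
proof -
  interpret spectral_rep \<mu> "neg_graph (A_hat \<Omega> B\<^sub>I c)" M U a
    using spectral by (rule spectral_rep.intro)
  \<comment> \<open>The real \<open>sqrt\<close> is total and odd, so the cosine is bounded by 1 for
    negative arguments as well.\<close>
  have cos_bounded: "(\<lambda>l. cos (\<tau> * sqrt l)) \<in> borel_measurable borel" "\<And>l. \<bar>cos (\<tau> * sqrt l)\<bar> \<le> 1"
    by simp_all
  interpret symmetric_operator \<mu> P
    unfolding propagator
    by (intro symmetric_operator.intro op_fun_spec(1)[OF cos_bounded] op_fun_symmetric[OF cos_bounded])
  define K where "K = blocks m (\<lambda>k j. (P ^^ k) (b j))"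
  have krylov: "krylov \<mu> m n P b = L2_span \<mu> (m * n) K"
    by (simp add: krylov_def K_def)
  have b: "b j \<in> L2 \<mu>" if "j < m" for j
    using transducers that unfolding is_op_fun_surface_def mu by simp
  have D: "D k = Matrix.mat m m (\<lambda>(p, q). moment \<tau> (b p) (b q) 0 k)" for k
    using b data by (intro eq_matI) (auto simp: inner_cos_op_fun)
  have interp: "interpolates n D X Y \<longleftrightarrow> (\<forall>i<2 * n. \<forall>p<m. \<forall>q<m.
      (transpose_mat Y * (X ^\<^sub>m i * Y)) $$ (p, q) = L2_inner \<mu> (b p) ((P ^^ i) (b q)))"
    if "X \<in> carrier_mat (m * n) (m * n)" "Y \<in> carrier_mat (m * n) m" for X Y
    using interpolates_iff_power_moments[OF that D moment_rec[OF b b]] b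
    by (simp add: propagator inner_propagator_power del: index_mult_mat)
  \<comment> \<open>The dimension hypothesis only provides some independent family of size
    \<open>m * n\<close> with this span; here independence is transferred to the Krylov functions
    themselves.\<close>
  have ind: "L2_independent \<mu> (m * n) K"
    using krylov_dim unfolding krylov by (rule spanning_imp_independent)
  show ?thesis
  proof (intro conjI allI impI)
    fix v
    assume v: "orthonormal_basis \<mu> (m * n) (blocks m v) (krylov \<mu> m n P b)"
    \<comment> \<open>Component \<open>j\<close> of block \<open>k\<close> has index k m + j in the
      concatenated row.\<close>
    have "(P ^^ k) (b j) \<in> L2_span \<mu> (m * n) (blocks m v)" if "k < n" "j < m" for k j
    proof -
      have "k * m + j < m * n"
      proof -
        have "k * m + j < (k + 1) * m" using that by simp
        also have "\<dots> \<le> n * m" using that by (intro mult_right_mono) auto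
        finally show ?thesis by (simp add: mult.commute)
      qed
      then have "K (k * m + j) \<in> L2_span \<mu> (m * n) K"
        by (rule L2_span_member)
      then show ?thesis
        using v that unfolding orthonormal_basis_def krylov by (simp add: K_def blocks_def)
    qed
    then show "interpolates n D (star \<mu> (m * n) (m * n) (blocks m v) (\<lambda>i. P (blocks m v i)))
        (star \<mu> (m * n) m (blocks m v) b)"
      using v b unfolding interp[OF star_carrier star_carrier] orthonormal_basis_def
      by (intro allI impI projection_moments) auto
  next
    fix Pt Bt
    assume *: "Pt \<in> carrier_mat (m * n) (m * n) \<and> Bt \<in> carrier_mat (m * n) m \<and>
      transpose_mat Pt = Pt \<and> interpolates n D Pt Bt"
    then have moments: "(transpose_mat Bt * (Pt ^\<^sub>m i * Bt)) $$ (p, q) = L2_inner \<mu> (b p) ((P ^^ i) (b q))"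
      if "i < 2 * n" "p < m" "q < m" for i p q
      using interp[of Pt Bt] that by blast
    have "\<exists>V. (\<forall>i<m * n. V i \<in> L2 \<mu>) \<and> star \<mu> (m * n) (m * n) V V = 1\<^sub>m (m * n) \<and>
      L2_span \<mu> (m * n) V = L2_span \<mu> (m * n) K \<and>
      Pt = star \<mu> (m * n) (m * n) V (\<lambda>i. P (V i)) \<and> Bt = star \<mu> (m * n) m V b"
      unfolding K_def
      by (rule realization_is_projection[OF counts(1) b _ _ _ counts(2) moments ind[unfolded K_def]])
        (use * in simp_all)
    then obtain V where "orthonormal_basis \<mu> (m * n) V (krylov \<mu> m n P b)"
      "Pt = star \<mu> (m * n) (m * n) V (\<lambda>i. P (V i))" "Bt = star \<mu> (m * n) m V b"
      unfolding orthonormal_basis_def krylov by blast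
    then show "\<exists>v. orthonormal_basis \<mu> (m * n) (blocks m v) (krylov \<mu> m n P b) \<and>
        Pt = star \<mu> (m * n) (m * n) (blocks m v) (\<lambda>i. P (blocks m v i)) \<and>
        Bt = star \<mu> (m * n) m (blocks m v) b"
      \<comment> \<open>The flat sequence \<open>V\<close> is cut into blocks of length
        \<open>m\<close>, inverse to the indexing used by \<open>blocks\<close>.\<close>
      by (intro exI[of _ "\<lambda>k j. V (k * m + j)"]) (simp add: blocks_surj)
  qed
qed

end
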